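(* Let $H\in(\frac13,\frac12]$, $\beta\in(\frac13,H)$, $p=\frac1\beta$, $q=\frac p2$, let $A\in\mathbb{R}^{m\times m}$, let $f:\mathbb{R}^m\to\mathbb{R}^m$ be globally Lipschitz continuous, and let $g\in C_b^3(\mathbb{R}^m,\mathbb{R}^{m\times d})$. Fix $\omega\in\Omega'$. Let $\tau\in\mathbb{R}$ and $T>0$. Let $y$ be the solution on $[\tau,\tau+T]$ of $$dy=(Ay+f(y))\,dt+g(y)\,d\boldsymbol{\omega},$$ and, for $\delta\in(0,1)$, let $y^\delta$ be the solution on $[\tau,\tau+T]$ of $$dy^\delta=(Ay^\delta+f(y^\delta))\,dt+g(y^\delta)\,d\boldsymbol{\omega}_\delta .$$ If $\|y^\delta_\tau-y_\tau\|\to0$ as $\delta\to0$, then $$\|y-y^\delta\|_{\infty,[\tau,\tau+T]}+|||y-y^\delta|||_{p\text{-var},[\tau,\tau+T]}+|||R^{y^\delta}-R^{y}|||_{q\text{-var},[\tau,\tau+T]^2}\to0\quad\text{as }\delta\to0 .$$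
   Context: Noise: $\omega^1$ is the canonical two-sided fractional Brownian motion in $\mathbb{R}^d$ with Hurst index $H$ and independent components (coordinate process on $\Omega\subset C_0(\mathbb{R},\mathbb{R}^d)$ under its law $\mathbb{P}_H$), and $\theta_t\omega(\cdot)=\omega(\cdot+t)-\omega(t)$. For $\delta\in(0,1)$ put $W_\delta(t,\omega^1)=\int_0^t\frac1\delta(\omega^1(r+\delta)-\omega^1(r))dr$, $\mathbb{W}_\delta(\omega^1)_{s,t}=\int_s^tW_\delta(\cdot,\omega^1)_{s,r}\otimes dW_\delta(r,\omega^1)$ and $\boldsymbol{\omega}_\delta=(W_\delta(\cdot,\omega^1),\mathbb{W}_\delta(\omega^1))$. $\boldsymbol{\omega}=(\omega^1,\omega^2)$ is the canonical geometric rough path lift of $\omega^1$ (for $i\ne j$, $\omega^{2,i,j}_{s,t}=\int_s^t\omega^{1,i}_{s,r}d\omega^{1,j}_r$ as $L^2$-limit of left-point Riemann sums; $\omega^{2,i,i}_{s,t}=\frac12(\omega^{1,i}_{s,t})^2$). $\Omega'\subset\Omega$ is a $\theta$-invariant set of full measure on which $\boldsymbol{\omega}$ is a geometric $\beta$-Hölder rough path on every compact interval and, for all $T>0$, $\sup_{-T\le s<t\le T}\frac{|\omega^1_{s,t}-W_\delta(\cdot,\omega^1)_{s,t}|}{|t-s|^\beta}+\sup_{-T\le s<t\le T}\frac{|\omega^2_{s,t}-\mathbb{W}_\delta(\omega^1)_{s,t}|}{|t-s|^{2\beta}}\to0$ as $\delta\to0$. Notation: $y_{s,t}=y_t-y_s$;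 $\|y\|_{\infty,I}=\sup_{t\in I}\|y_t\|$; $|||y|||_{p\text{-var},I}=\big(\sup_{\mathcal{P}(I)}\sum_{[u,v]\in\mathcal{P}(I)}\|y_{u,v}\|^p\big)^{1/p}$ over partitions of $I$; for two-parameter maps $|||R|||_{q\text{-var},I^2}=\big(\sup_{\mathcal{P}(I)}\sum_{[u,v]\in\mathcal{P}(I)}\|R_{u,v}\|^q\big)^{1/q}$. $g\in C_b^3$ means $g$ is three times continuously differentiable with $g,Dg,D^2g,D^3g$ bounded. Solutions: a solution of $dy=(Ay+f(y))dt+g(y)d\boldsymbol{X}$ on $I=[\tau,\tau+T]$, driven by a $\beta$-Hölder rough path $\boldsymbol{X}=(X,\mathbb{X})$, is a path $y\in C^\beta(I,\mathbb{R}^m)$ which is controlled by $X$ with Gubinelli derivative $y'=g(y)$, i.e. $R^y_{s,t}:=y_{s,t}-g(y_s)X_{s,t}$ is $2\beta$-Hölder ($\sup_{s<t}\|R^y_{s,t}\|/|t-s|^{2\beta}<\infty$), and which satisfies $y_{s,t}=\int_s^t(Ay_r+f(y_r))dr+\int_s^tg(y_r)d\boldsymbol{X}_r$ for all $s<t\in I$, where the rough integral is $\int_s^tg(y_r)d\boldsymbol{X}_r=\lim_{|\mathcal{P}|\to0}\sum_{[u,v]\in\mathcal{P}}\left(g(y_u)X_{u,v}+Dg(y_u)g(y_u)\mathbb{X}_{u,v}\right)$ over partitions $\mathcal{P}$ of $[s,t]$. Under the stated assumptions such a solution exists and is unique for each initial value $y_\tau$. Here $R^y_{s,t}=y_{s,t}-g(y_s)\omega^1_{s,t}$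 and $R^{y^\delta}_{s,t}=y^\delta_{s,t}-g(y^\delta_s)W_\delta(\cdot,\omega^1)_{s,t}$. *)

theory Defs
  imports "HOL-Probability.Probability"
begin

subsection \<open>Partitions, increments, variation and Hoelder norms\<close>

text \<open>A partition of \<open>[a,b]\<close> is the strictly increasing list of its points.\<close>

definition is_partition :: "real \<Rightarrow> real \<Rightarrow> real list \<Rightarrow> bool" where
  "is_partition a b ts \<longleftrightarrow> ts \<noteq> [] \<and> hd ts = a \<and> last ts = b \<and> sorted_wrt (<) ts"

definition partition_sum :: "real list \<Rightarrow> (real \<Rightarrow> real \<Rightarrow> 'a::comm_monoid_add) \<Rightarrow> 'a" where
  "partition_sum ts F = (\<Sum>k<length ts - 1. F (ts ! k) (ts ! Suc k))"

text \<open>The filter expressing ``as the mesh of the partition of \<open>[a,b]\<close> tends to \<open>0\<close>''.\<close>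

definition fine_partitions :: "real \<Rightarrow> real \<Rightarrow> real list filter" where
  "fine_partitions a b = (INF \<eta>\<in>{0<..}. principal
     {ts. is_partition a b ts \<and> (\<forall>k<length ts - 1. ts ! Suc k - ts ! k < \<eta>)})"

definition incr :: "(real \<Rightarrow> 'a::ab_group_add) \<Rightarrow> real \<Rightarrow> real \<Rightarrow> 'a" where
  "incr y s t = y t - y s"

text \<open>All norms are suprema in \<open>[0,\<infinity>]\<close>, so that they are meaningful without any a priori
  finiteness. One-parameter paths enter the variation and Hoelder norms through \<^const>\<open>incr\<close>.\<close>

definition ennreal_powr :: "ennreal \<Rightarrow> real \<Rightarrow> ennreal" where
  "ennreal_powr x r = (if x = top then top else ennreal (enn2real x powr r))"

definition sup_norm :: "real \<Rightarrow> real \<Rightarrow> (real \<Rightarrow> 'a::real_normed_vector) \<Rightarrow> ennreal" where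
  "sup_norm a b y = (SUP t\<in>{a..b}. ennreal (norm (y t)))"

definition p_var :: "real \<Rightarrow> real \<Rightarrow> real \<Rightarrow> (real \<Rightarrow> real \<Rightarrow> 'a::real_normed_vector) \<Rightarrow> ennreal" where
  "p_var p a b F = ennreal_powr
     (SUP ts\<in>{ts. is_partition a b ts}. ennreal (partition_sum ts (\<lambda>u v. norm (F u v) powr p)))
     (1 / p)"

definition hoelder :: "real \<Rightarrow> real \<Rightarrow> real \<Rightarrow> (real \<Rightarrow> real \<Rightarrow> 'a::real_normed_vector) \<Rightarrow> ennreal" where
  "hoelder \<gamma> a b F =
     (SUP (s, t)\<in>{(s, t). a \<le> s \<and> s < t \<and> t \<le> b}. ennreal (norm (F s t) / (t - s) powr \<gamma>))"

subsection \<open>Rough paths\<close>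

text \<open>Tensors in \<open>\<real>\<^sup>d \<otimes> \<real>\<^sup>d\<close> are matrices, with \<open>(x \<otimes> y)\<close> having entries
  \<open>x\<^sub>i y\<^sub>j\<close>; hence the entry \<open>XX s t $ i $ j\<close> stands for
  \<open>\<integral>\<^sub>s\<^sup>t X\<^sup>i\<^sub>s\<^sub>,\<^sub>r dX\<^sup>j\<^sub>r\<close>.\<close>

definition outer :: "real^'d \<Rightarrow> real^'d \<Rightarrow> real^'d^'d" where
  "outer x y = (\<chi> i j. x $ i * y $ j)"

definition rough_path ::
  "real \<Rightarrow> real \<Rightarrow> real \<Rightarrow> (real \<Rightarrow> real^'d) \<Rightarrow> (real \<Rightarrow> real \<Rightarrow> real^'d^'d) \<Rightarrow> bool" where
  "rough_path \<beta> a b X XX \<longleftrightarrow>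
     hoelder \<beta> a b (incr X) < top \<and> hoelder (2 * \<beta>) a b XX < top \<and>
     (\<forall>s u t. a \<le> s \<and> s \<le> u \<and> u \<le> t \<and> t \<le> b \<longrightarrow>
        XX s t - XX s u - XX u t = outer (incr X s u) (incr X u t))"

text \<open>For a continuously differentiable path \<open>X\<close>, integration against \<open>dX\<close> is integration
  against the derivative: \<open>dX\<^sub>r = X'\<^sub>r dr\<close>.\<close>

definition smooth_lift :: "(real \<Rightarrow> real^'d) \<Rightarrow> real \<Rightarrow> real \<Rightarrow> real^'d^'d" where
  "smooth_lift X s t = integral {s..t} (\<lambda>r. outer (incr X s r) (vector_derivative X (at r)))"

text \<open>Geometric rough paths: limits, in the rough path metric, of lifts of smooth paths. The
  closure does not depend on whether smooth means once continuously or infinitely often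
  differentiable.\<close>

definition geometric_rough_path ::
  "real \<Rightarrow> real \<Rightarrow> real \<Rightarrow> (real \<Rightarrow> real^'d) \<Rightarrow> (real \<Rightarrow> real \<Rightarrow> real^'d^'d) \<Rightarrow> bool" where
  "geometric_rough_path \<beta> a b X XX \<longleftrightarrow> rough_path \<beta> a b X XX \<and>
     (\<exists>Y :: nat \<Rightarrow> real \<Rightarrow> real^'d. (\<forall>n. Y n C1_differentiable_on UNIV) \<and>
        (\<lambda>n. hoelder \<beta> a b (\<lambda>s t. incr X s t - incr (Y n) s t)
            + hoelder (2 * \<beta>) a b (\<lambda>s t. XX s t - smooth_lift (Y n) s t)) \<longlonglongrightarrow> 0)"

subsection \<open>Solutions of rough differential equations\<close>

definition C3_bounded :: "('a::real_normed_vector \<Rightarrow> 'b::real_normed_vector) \<Rightarrow> bool" where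
  "C3_bounded g \<longleftrightarrow>
     (\<exists>(D1 :: 'a \<Rightarrow> 'a \<Rightarrow>\<^sub>L 'b) (D2 :: 'a \<Rightarrow> 'a \<Rightarrow>\<^sub>L 'a \<Rightarrow>\<^sub>L 'b)
        (D3 :: 'a \<Rightarrow> 'a \<Rightarrow>\<^sub>L 'a \<Rightarrow>\<^sub>L 'a \<Rightarrow>\<^sub>L 'b).
        (\<forall>x. (g has_derivative blinfun_apply (D1 x)) (at x)) \<and>
        (\<forall>x. (D1 has_derivative blinfun_apply (D2 x)) (at x)) \<and>
        (\<forall>x. (D2 has_derivative blinfun_apply (D3 x)) (at x)) \<and>
        continuous_on UNIV D3 \<and>
        bounded (range g) \<and> bounded (range D1) \<and> bounded (range D2) \<and> bounded (range D3))"

text \<open>The vector \<open>Dg(y) g(y) M\<close>, i.e. the sum over \<open>i, j\<close> of \<open>M\<^sub>i\<^sub>j\<close> times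
  the derivative of the \<open>j\<close>-th column of \<open>g\<close> at \<open>y\<close> in the direction of the
  \<open>i\<close>-th column of \<open>g(y)\<close>.\<close>

definition Dg_g :: "(real^'m \<Rightarrow> real^'d^'m) \<Rightarrow> real^'m \<Rightarrow> real^'d^'d \<Rightarrow> real^'m" where
  "Dg_g g y M =
     (\<Sum>i\<in>UNIV. \<Sum>j\<in>UNIV. M $ i $ j *\<^sub>R column j (frechet_derivative g (at y) (column i (g y))))"

definition has_rough_integral ::
  "(real^'m \<Rightarrow> real^'d^'m) \<Rightarrow> (real \<Rightarrow> real^'m) \<Rightarrow> (real \<Rightarrow> real^'d) \<Rightarrow> (real \<Rightarrow> real \<Rightarrow> real^'d^'d)
    \<Rightarrow> real \<Rightarrow> real \<Rightarrow> real^'m \<Rightarrow> bool" where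
  "has_rough_integral g y X XX s t J \<longleftrightarrow>
     ((\<lambda>ts. partition_sum ts (\<lambda>u v. g (y u) *v incr X u v + Dg_g g (y u) (XX u v)))
        \<longlongrightarrow> J) (fine_partitions s t)"

definition remainder ::
  "(real^'m \<Rightarrow> real^'d^'m) \<Rightarrow> (real \<Rightarrow> real^'d) \<Rightarrow> (real \<Rightarrow> real^'m) \<Rightarrow> real \<Rightarrow> real \<Rightarrow> real^'m" where
  "remainder g X y s t = incr y s t - g (y s) *v incr X s t"

definition rde_solution ::
  "real \<Rightarrow> real^'m^'m \<Rightarrow> (real^'m \<Rightarrow> real^'m) \<Rightarrow> (real^'m \<Rightarrow> real^'d^'m)
    \<Rightarrow> (real \<Rightarrow> real^'d) \<Rightarrow> (real \<Rightarrow> real \<Rightarrow> real^'d^'d) \<Rightarrow> real \<Rightarrow> real \<Rightarrow> (real \<Rightarrow> real^'m) \<Rightarrow> bool" where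
  "rde_solution \<beta> A f g X XX a b y \<longleftrightarrow>
     hoelder \<beta> a b (incr y) < top \<and>
     hoelder (2 * \<beta>) a b (remainder g X y) < top \<and>
     (\<forall>s t. a \<le> s \<and> s < t \<and> t \<le> b \<longrightarrow>
        (\<exists>J. has_rough_integral g y X XX s t J \<and>
             incr y s t = integral {s..t} (\<lambda>r. A *v y r + f (y r)) + J))"

subsection \<open>Fractional Brownian motion and its lift\<close>

text \<open>Gaussian random variables may be degenerate.\<close>

definition gaussian_rv :: "'w measure \<Rightarrow> ('w \<Rightarrow> real) \<Rightarrow> bool" where
  "gaussian_rv M Z \<longleftrightarrow> Z \<in> borel_measurable M \<and>
     ((\<exists>c. AE w in M. Z w = c) \<or>
      (\<exists>\<mu> \<sigma>. \<sigma> > 0 \<and> distributed M lborel Z (\<lambda>x. ennreal (normal_density \<mu> \<sigma> x))))"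

definition gaussian_process :: "'w measure \<Rightarrow> (real \<Rightarrow> 'w \<Rightarrow> real) \<Rightarrow> bool" where
  "gaussian_process M B \<longleftrightarrow>
     (\<forall>S c. finite S \<longrightarrow> gaussian_rv M (\<lambda>w. \<Sum>t\<in>S. c t * B t w))"

definition fractional_brownian_motion :: "real \<Rightarrow> 'w measure \<Rightarrow> (real \<Rightarrow> 'w \<Rightarrow> real) \<Rightarrow> bool" where
  "fractional_brownian_motion H M B \<longleftrightarrow>
     gaussian_process M B \<and>
     (\<forall>t. prob_space.expectation M (B t) = 0) \<and>
     (\<forall>s t. prob_space.expectation M (\<lambda>w. B s w * B t w)
        = (\<bar>s\<bar> powr (2 * H) + \<bar>t\<bar> powr (2 * H) - \<bar>t - s\<bar> powr (2 * H)) / 2) \<and>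
     (\<forall>w\<in>space M. continuous_on UNIV (\<lambda>t. B t w))"

text \<open>\<open>P\<close> is the law of \<open>d\<close>-dimensional fractional Brownian motion on a path space
  \<open>\<Omega> = space P\<close> contained in \<open>C\<^sub>0(\<real>, \<real>\<^sup>d)\<close>. The sigma algebra is the trace of the
  product sigma algebra, which on \<open>C\<^sub>0\<close> is the Borel sigma algebra of locally uniform
  convergence.\<close>

definition canonical_fbm :: "real \<Rightarrow> (real \<Rightarrow> real^'d) measure \<Rightarrow> bool" where
  "canonical_fbm H P \<longleftrightarrow>
     prob_space P \<and>
     space P \<subseteq> {w. continuous_on UNIV w \<and> w 0 = 0} \<and>
     sets P = sets (restrict_space (Pi\<^sub>M UNIV (\<lambda>_. borel)) (space P)) \<and>
     (\<forall>i. fractional_brownian_motion H P (\<lambda>t w. w t $ i)) \<and>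
     prob_space.indep_vars P (\<lambda>_. Pi\<^sub>M UNIV (\<lambda>_. borel)) (\<lambda>i w t. w t $ i) UNIV"

definition shift :: "real \<Rightarrow> (real \<Rightarrow> real^'d) \<Rightarrow> real \<Rightarrow> real^'d" where
  "shift t w = (\<lambda>r. w (r + t) - w t)"

text \<open>The off-diagonal entries of the second level are mean square limits of left-point Riemann
  sums. They are thereby determined almost surely for each pair \<open>s \<le> t\<close>; \<open>L\<close> is any
  version.\<close>

definition canonical_lift ::
  "(real \<Rightarrow> real^'d) measure \<Rightarrow> ((real \<Rightarrow> real^'d) \<Rightarrow> real \<Rightarrow> real \<Rightarrow> real^'d^'d) \<Rightarrow> bool" where
  "canonical_lift P L \<longleftrightarrow>
     (\<forall>i j s t. s \<le> t \<longrightarrow>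
        (\<lambda>w. L w s t $ i $ j) \<in> borel_measurable P \<and>
        (if i = j then \<forall>w\<in>space P. L w s t $ i $ j = (incr w s t $ i)\<^sup>2 / 2
         else ((\<lambda>ts. \<integral>\<^sup>+ w. ennreal ((partition_sum ts (\<lambda>u v. incr w s u $ i * incr w u v $ j)
                                  - L w s t $ i $ j)\<^sup>2) \<partial>P) \<longlongrightarrow> 0) (fine_partitions s t)))"

text \<open>The integral from \<open>0\<close> to \<open>t\<close> is oriented, so \<open>t\<close> may be negative.\<close>

definition W_approx :: "real \<Rightarrow> (real \<Rightarrow> real^'d) \<Rightarrow> real \<Rightarrow> real^'d" where
  "W_approx \<delta> w t = (LBINT r=0..ereal t. (1 / \<delta>) *\<^sub>R (w (r + \<delta>) - w r))"

definition WW_approx :: "real \<Rightarrow> (real \<Rightarrow> real^'d) \<Rightarrow> real \<Rightarrow> real \<Rightarrow> real^'d^'d" where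
  "WW_approx \<delta> w = smooth_lift (W_approx \<delta> w)"

text \<open>The properties of the set \<open>\<Omega>'\<close> on which the rough differential equations are
  solved pathwise.\<close>

definition good_set ::
  "real \<Rightarrow> (real \<Rightarrow> real^'d) measure \<Rightarrow> ((real \<Rightarrow> real^'d) \<Rightarrow> real \<Rightarrow> real \<Rightarrow> real^'d^'d)
    \<Rightarrow> (real \<Rightarrow> real^'d) set \<Rightarrow> bool" where
  "good_set \<beta> P L \<Omega>' \<longleftrightarrow>
     \<Omega>' \<subseteq> space P \<and> (AE w in P. w \<in> \<Omega>') \<and> (\<forall>t. shift t ` \<Omega>' = \<Omega>') \<and>
     (\<forall>w\<in>\<Omega>'. \<forall>a b. a \<le> b \<longrightarrow> geometric_rough_path \<beta> a b w (L w)) \<and>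
     (\<forall>w\<in>\<Omega>'. \<forall>T>0.
        ((\<lambda>\<delta>. hoelder \<beta> (- T) T (\<lambda>s t. incr w s t - incr (W_approx \<delta> w) s t)
            + hoelder (2 * \<beta>) (- T) T (\<lambda>s t. L w s t - WW_approx \<delta> w s t)) \<longlongrightarrow> 0) (at_right 0))"

end

theory Submission
  imports Defs
begin

text \<open>
  The theorem is deterministic. The law of fractional Brownian motion enters only through the
  convergence of the lifts of \<open>W_approx \<delta> \<omega>\<close> to \<open>(\<omega>, \<omega>2 \<omega>)\<close> in the \<open>\<beta>\<close>-Hoelder rough path metric, which
  is part of \<open>good_set\<close>. What has to be proved is that the solution of a rough differential equation
  depends continuously on the initial value and on the driving rough path (\<open>rde_stability\<close>). It is
  enough to work with Hoelder bounds: as \<open>p * \<beta> = 1\<close> and \<open>q * (2 * \<beta>) = 1\<close>, a bound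
  \<open>C (t - s)^\<beta>\<close> on increments bounds the \<open>p\<close>-variation, and a bound \<open>C (t - s)^(2\<beta>)\<close> on the remainders
  bounds the \<open>q\<close>-variation (\<open>p_var_le_of_incr_bound\<close>).

  Write \<open>r = (t - s)^\<beta>\<close> and let the germ be the summand \<open>g(y) X + Dg(y) g(y) XX\<close> of the rough
  integral. By the relation of Chen the germ is additive up to an error of order \<open>r^3\<close>
  (\<open>germ_defect\<close>), and since \<open>3 * \<beta> > 1\<close> the sewing lemma (\<open>sewing_bound\<close>) gives
  \<open>R s t = \<integral> b(y) + Dg(y s) g(y s) XX s t + O(r^3)\<close>. The constant in the last term involves the bound of
  \<open>R\<close> itself, but \<open>r^3\<close> is \<open>r\<close> times \<open>r^2\<close>: on a window so short that \<open>r\<close> is small, the unknown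
  bound reappears with a factor at most one half and can be absorbed. This yields a bound on \<open>R\<close> that is
  uniform over all approximations (\<open>a_priori_bound\<close>). The same argument, applied to the difference of
  the expansions of two solutions, bounds the difference of the solutions and of their remainders by a
  multiple of \<open>\<epsilon>\<close>, the sum of the distances of the drivers and of the initial values
  (\<open>difference_bound\<close>). Here \<open>g\<close> needs three bounded derivatives, since the difference of the
  defects contains second differences of \<open>Dg(y) g(y)\<close>.

  The window length does not depend on the approximation, so finitely many windows carry the
  estimate over the whole interval.
\<close>

section \<open>A quantitative sewing lemma\<close>

lemma sum_even_odd_split:
  fixes f :: "nat \<Rightarrow> 'a::comm_monoid_add"
  shows "(\<Sum>k<2 * n. f k) = (\<Sum>k<n. f (2 * k) + f (Suc (2 * k)))"
  by (induction n) (simp_all add: algebra_simps)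

definition dyadic_partition :: "real \<Rightarrow> real \<Rightarrow> nat \<Rightarrow> real list" where
  "dyadic_partition s t n = map (\<lambda>k. s + real k * ((t - s) / 2 ^ n)) [0..<Suc (2 ^ n)]"

lemma dyadic_partition_nth:
  "k \<le> 2 ^ n \<Longrightarrow> dyadic_partition s t n ! k = s + real k * ((t - s) / 2 ^ n)"
  unfolding dyadic_partition_def by (subst nth_map) (auto simp del: upt_Suc)

lemma length_dyadic_partition: "length (dyadic_partition s t n) = Suc (2 ^ n)"
  by (simp add: dyadic_partition_def)

lemma is_partition_dyadic:
  assumes "s < t" shows "is_partition s t (dyadic_partition s t n)"
proof -
  have "dyadic_partition s t n \<noteq> []"
    by (simp add: dyadic_partition_def)
  moreover from this have "hd (dyadic_partition s t n) = s" "last (dyadic_partition s t n) = t"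
    by (simp_all add: hd_conv_nth last_conv_nth dyadic_partition_nth length_dyadic_partition)
  moreover have "sorted_wrt (<) (dyadic_partition s t n)"
    using assms by (auto simp: sorted_wrt_iff_nth_less length_dyadic_partition dyadic_partition_nth
        intro!: mult_strict_right_mono divide_pos_pos simp del: times_divide_eq_right)
  ultimately show ?thesis by (simp add: is_partition_def)
qed

lemma filterlim_dyadic_partition:
  assumes "s < t"
  shows "filterlim (dyadic_partition s t) (fine_partitions s t) sequentially"
  unfolding fine_partitions_def filterlim_INF filterlim_principal
proof
  fix \<eta> :: real assume "\<eta> \<in> {0<..}"
  then have "\<eta> > 0" by simp
  have "(\<lambda>n. (t - s) * (1 / 2) ^ n) \<longlonglongrightarrow> (t - s) * 0"
    by (intro tendsto_mult tendsto_const LIMSEQ_realpow_zero) auto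
  then have ev: "eventually (\<lambda>n. (t - s) * (1 / 2) ^ n < \<eta>) sequentially"
    using \<open>\<eta> > 0\<close> by (intro order_tendstoD(2)[where y = "(t - s) * 0"]) auto
  show "\<forall>\<^sub>F n in sequentially. dyadic_partition s t n \<in> {ts. is_partition s t ts \<and>
      (\<forall>k<length ts - 1. ts ! Suc k - ts ! k < \<eta>)}"
    using ev
  proof eventually_elim
    case (elim n)
    then show ?case
      using is_partition_dyadic[OF assms]
      by (auto simp: length_dyadic_partition dyadic_partition_nth algebra_simps power_divide add_divide_distrib diff_divide_distrib)
  qed
qed

lemma partition_sum_dyadic:
  "partition_sum (dyadic_partition s t n) F =
     (\<Sum>k<2 ^ n. F (s + real k * ((t - s) / 2 ^ n)) (s + real (Suc k) * ((t - s) / 2 ^ n)))"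
  unfolding partition_sum_def length_dyadic_partition
  by (intro sum.cong) (auto simp: dyadic_partition_nth simp del: of_nat_Suc)

text \<open>Halving every interval of the dyadic partition of generation \<open>n\<close> changes the sum by at most
  \<open>2^n\<close> defects at scale \<open>2^-n (t - s)\<close>. As \<open>\<theta> > 1\<close>, these changes form a geometric series that
  converges, and its sum controls the distance from the trivial partition to the limit. The limit \<open>J\<close> is a
  hypothesis because the notion of solution provides it.\<close>

lemma sewing_bound:
  fixes F :: "real \<Rightarrow> real \<Rightarrow> 'a::real_normed_vector"
  assumes "s < t" and "\<theta> > 1" and "C \<ge> 0"
    and defect: "\<And>x u v. s \<le> x \<Longrightarrow> x \<le> u \<Longrightarrow> u \<le> v \<Longrightarrow> v \<le> t \<Longrightarrow>
          norm (F x v - F x u - F u v) \<le> C * (v - x) powr \<theta>"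
    and lim: "((\<lambda>ts. partition_sum ts F) \<longlongrightarrow> J) (fine_partitions s t)"
  shows "norm (J - F s t) \<le> C * (t - s) powr \<theta> / (1 - 2 powr (1 - \<theta>))"
proof -
  define S where "S n = partition_sum (dyadic_partition s t n) F" for n
  define x where "x = 2 powr (1 - \<theta>)"
  have x: "0 < x" "x < 1" using \<open>\<theta> > 1\<close> by (auto simp: x_def powr_less_one)
  have "S \<longlonglongrightarrow> J"
    unfolding S_def using filterlim_compose[OF lim filterlim_dyadic_partition[OF \<open>s < t\<close>]] .
  have step: "norm (S (Suc n) - S n) \<le> C * (t - s) powr \<theta> * x ^ n" for n
  proof -
    define h where "h = (t - s) / 2 ^ n"
    have h: "h > 0" using \<open>s < t\<close> by (simp add: h_def)
    have h2: "(t - s) / 2 ^ Suc n = h / 2" by (simp add: h_def)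
    have eq: "S (Suc n) - S n = (\<Sum>k<2 ^ n. - (F (s + real k * h) (s + real (Suc k) * h)
        - F (s + real k * h) (s + (real k + 1/2) * h)
        - F (s + (real k + 1/2) * h) (s + real (Suc k) * h)))"
    proof -
      have "S (Suc n) = (\<Sum>k<2 * 2 ^ n. F (s + real k * (h/2)) (s + real (Suc k) * (h/2)))"
        unfolding S_def partition_sum_dyadic h2 by simp
      also have "\<dots> = (\<Sum>k<2 ^ n. F (s + real k * h) (s + (real k + 1/2) * h)
          + F (s + (real k + 1/2) * h) (s + real (Suc k) * h))"
        unfolding sum_even_odd_split
        by (intro sum.cong refl arg_cong2[where f = "(+)"] arg_cong2[where f = F]) (auto simp: field_simps)
      finally show ?thesis
        unfolding S_def partition_sum_dyadic h_def[symmetric]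
        by (simp add: sum_subtractf[symmetric] algebra_simps del: of_nat_Suc)
    qed
    have "norm (S (Suc n) - S n) \<le> (\<Sum>k<(2::nat) ^ n. C * h powr \<theta>)"
      unfolding eq
    proof (rule sum_norm_le)
      fix k assume "k \<in> {..<(2::nat) ^ n}"
      then have "real (Suc k) \<le> 2 ^ n"
        by (metis Suc_leI lessThan_iff of_nat_le_iff of_nat_numeral of_nat_power)
      then have "real (Suc k) * h \<le> 2 ^ n * h" using h by (intro mult_right_mono) auto
      then have "s + real (Suc k) * h \<le> t" by (simp add: h_def)
      moreover have "real (Suc k) * h - real k * h = h" by (simp add: algebra_simps)
      ultimately show "norm (- (F (s + real k * h) (s + real (Suc k) * h)
        - F (s + real k * h) (s + (real k + 1/2) * h)
        - F (s + (real k + 1/2) * h) (s + real (Suc k) * h))) \<le> C * h powr \<theta>"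
        using defect[of "s + real k * h" "s + (real k + 1/2) * h" "s + real (Suc k) * h"] h
        by (auto simp only: norm_minus_cancel add_diff_add) (auto simp: mult_right_mono)
    qed
    also have "\<dots> = C * (2 ^ n * h powr \<theta>)" by simp
    also have "2 ^ n * h powr \<theta> = (t - s) powr \<theta> * x ^ n"
    proof -
      have "h powr \<theta> = (t - s) powr \<theta> / (2 ^ n) powr \<theta>"
        using \<open>s < t\<close> by (simp add: h_def powr_divide)
      moreover have "(2 ^ n) powr \<theta> = (2 powr \<theta>) ^ n"
        by (simp add: powr_powr powr_realpow[symmetric] mult.commute)
      ultimately show ?thesis
        by (simp add: x_def powr_diff power_divide)
    qed
    finally show ?thesis by (simp add: mult.assoc)
  qed
  have "norm (S n - S 0) \<le> C * (t - s) powr \<theta> / (1 - x)" for n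
  proof -
    have "S n - S 0 = (\<Sum>k<n. S (Suc k) - S k)" by (simp add: sum_lessThan_telescope)
    then have "norm (S n - S 0) \<le> (\<Sum>k<n. C * (t - s) powr \<theta> * x ^ k)"
      using step by (auto intro: sum_norm_le)
    also have "\<dots> = C * (t - s) powr \<theta> * (\<Sum>k<n. x ^ k)" by (simp add: sum_distrib_left)
    also have "(\<Sum>k<n. x ^ k) \<le> 1 / (1 - x)"
      using x by (simp add: sum_gp_strict divide_right_mono)
    finally show ?thesis using \<open>C \<ge> 0\<close> by (simp add: mult_left_mono)
  qed
  moreover have "(\<lambda>n. norm (S n - S 0)) \<longlonglongrightarrow> norm (J - S 0)"
    by (intro tendsto_intros \<open>S \<longlonglongrightarrow> J\<close>)
  ultimately have "norm (J - S 0) \<le> C * (t - s) powr \<theta> / (1 - x)"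
    by (meson LIMSEQ_le_const2)
  moreover have "S 0 = F s t" by (simp add: S_def partition_sum_dyadic)
  ultimately show ?thesis by (simp add: x_def)
qed

section \<open>Second differences and Taylor remainders\<close>

lemma norm_matrix_vector_mult_le:
  fixes A :: "real^'n^'m"
  shows "norm (A *v x) \<le> norm A * norm x"
proof -
  have "norm (A *v x) \<le> L2_set (\<lambda>i. norm x * norm (A $ i)) UNIV"
    unfolding norm_vec_def[of "A *v x"]
    by (rule L2_set_mono)
       (use Cauchy_Schwarz_ineq2 in \<open>auto simp: matrix_vector_mul_component mult.commute[of "norm x"]\<close>)
  also have "\<dots> = norm A * norm x"
    by (simp add: norm_vec_def[of A] L2_set_right_distrib[symmetric] mult.commute)
  finally show ?thesis .
qed

lemma norm_diff_le_of_derivative_bound: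
  fixes F :: "'a::real_normed_vector \<Rightarrow> 'b::real_normed_vector"
    and F' :: "'a \<Rightarrow> 'a \<Rightarrow>\<^sub>L 'b"
  assumes "convex S" and "\<And>x. x \<in> S \<Longrightarrow> (F has_derivative blinfun_apply (F' x)) (at x)"
    and "\<And>x. x \<in> S \<Longrightarrow> norm (F' x) \<le> C" and "x \<in> S" and "y \<in> S"
  shows "norm (F x - F y) \<le> C * norm (x - y)"
  using assms
  by (intro differentiable_bound[of S F "\<lambda>x. blinfun_apply (F' x)"])
     (auto intro: has_derivative_at_withinI simp: norm_blinfun.rep_eq[symmetric])

text \<open>The third clause controls the difference of the increments of \<open>F\<close> along two segments. It is
  the form in which the regularity of the coefficients is used when two solutions are compared, and it
  is kept symmetric in the end points so that products inherit it. For a bounded function, a derivative that is bounded and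
  Lipschitz suffices.\<close>

definition four_point_bound ::
  "real \<Rightarrow> ('a::real_normed_vector \<Rightarrow> 'b::real_normed_vector) \<Rightarrow> bool" where
  "four_point_bound C F \<longleftrightarrow>
     (\<forall>x. norm (F x) \<le> C) \<and> (\<forall>x y. norm (F x - F y) \<le> C * norm (x - y)) \<and>
     (\<forall>a a' c c'. norm (F a' - F a - (F c' - F c)) \<le>
        C * (norm ((a' - a) - (c' - c)) + (norm (a - c) + norm (a' - c')) * (norm (a' - a) + norm (c' - c))))"

text \<open>Mean value theorem for \<open>x \<mapsto> F (x + v) - F x\<close>, whose derivative is small with \<open>v\<close>.\<close>

lemma four_point_shift:
  fixes F :: "'a::real_normed_vector \<Rightarrow> 'b::real_normed_vector"
    and F' :: "'a \<Rightarrow> 'a \<Rightarrow>\<^sub>L 'b"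
  assumes deriv: "\<And>x. (F has_derivative blinfun_apply (F' x)) (at x)"
    and lip: "\<And>x y. norm (F' x - F' y) \<le> C * norm (x - y)"
  shows "norm (F (a + v) - F a - (F (c + v) - F c)) \<le> C * norm v * norm (a - c)"
proof (rule norm_diff_le_of_derivative_bound[of UNIV "\<lambda>x. F (x + v) - F x" "\<lambda>x. F' (x + v) - F' x"])
  fix x
  have "((\<lambda>x. F (x + v)) has_derivative blinfun_apply (F' (x + v))) (at x)"
    by (rule has_derivative_eq_rhs[OF has_derivative_compose[OF _ deriv]])
       (auto intro!: derivative_eq_intros)
  then have "((\<lambda>x. F (x + v) - F x) has_derivative (\<lambda>h. F' (x + v) h - F' x h)) (at x)"
    by (intro has_derivative_diff deriv)
  then show "((\<lambda>x. F (x + v) - F x) has_derivative blinfun_apply (F' (x + v) - F' x)) (at x)"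
    by (simp add: blinfun.diff_left[abs_def])
  show "norm (F' (x + v) - F' x) \<le> C * norm v" using lip[of "x + v" x] by simp
qed auto

text \<open>Move one segment parallel to itself onto the starting point of the other; the mismatch of the
  end points that is left is a plain Lipschitz term.\<close>

lemma four_point_boundI:
  fixes F :: "'a::real_normed_vector \<Rightarrow> 'b::real_normed_vector"
    and F' :: "'a \<Rightarrow> 'a \<Rightarrow>\<^sub>L 'b"
  assumes "\<And>x. norm (F x) \<le> C"
    and deriv: "\<And>x. (F has_derivative blinfun_apply (F' x)) (at x)"
    and bd: "\<And>x. norm (F' x) \<le> C"
    and lip: "\<And>x y. norm (F' x - F' y) \<le> C * norm (x - y)"
  shows "four_point_bound C F"
proof -
  have C: "C \<ge> 0" using bd[of 0] norm_ge_zero order_trans by blast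
  have L: "norm (F x - F y) \<le> C * norm (x - y)" for x y
    by (rule norm_diff_le_of_derivative_bound[of UNIV F F']) (use deriv bd in auto)
  have "norm (F a' - F a - (F c' - F c)) \<le>
        C * (norm ((a' - a) - (c' - c)) + (norm (a - c) + norm (a' - c')) * (norm (a' - a) + norm (c' - c)))"
    for a a' c c'
  proof -
    define v where "v = a' - a"
    have "norm (F (a + v) - F a - (F (c + v) - F c)) \<le> C * norm v * norm (a - c)"
      using four_point_shift[of F F', OF deriv lip] .
    moreover have "norm (F (c + v) - F c') \<le> C * norm (v - (c' - c))"
      using L[of "c + v" c'] by (simp add: algebra_simps)
    moreover have "F a' - F a - (F c' - F c) =
        (F (a + v) - F a - (F (c + v) - F c)) + (F (c + v) - F c')"
      by (simp add: v_def)
    ultimately have "norm (F a' - F a - (F c' - F c)) \<le>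
        C * norm v * norm (a - c) + C * norm (v - (c' - c))"
      by (metis norm_triangle_mono)
    also have "C * norm v * norm (a - c) = C * (norm (a - c) * norm v)" by simp
    also have "\<dots> \<le> C * ((norm (a - c) + norm (a' - c')) * (norm v + norm (c' - c)))"
      using C by (intro mult_left_mono mult_mono) auto
    finally show ?thesis by (simp add: v_def algebra_simps)
  qed
  then show ?thesis using assms L by (simp add: four_point_bound_def)
qed

lemma taylor_remainder_lipschitz:
  fixes F :: "'a::real_normed_vector \<Rightarrow> 'b::real_normed_vector"
    and F' :: "'a \<Rightarrow> 'a \<Rightarrow>\<^sub>L 'b"
  assumes deriv: "\<And>x. (F has_derivative blinfun_apply (F' x)) (at x)"
    and lip: "\<And>x y. norm (F' x - F' y) \<le> C * norm (x - y)" and "C \<ge> 0"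
  shows "norm ((F (a + v) - F a - F' a v) - (F (a + w) - F a - F' a w))
         \<le> C * (norm v + norm w) * norm (v - w)"
proof (rule norm_diff_le_of_derivative_bound[of "cball 0 (norm v + norm w)"
      "\<lambda>v. F (a + v) - F a - F' a v" "\<lambda>v. F' (a + v) - F' a"])
  fix x :: 'a assume x: "x \<in> cball 0 (norm v + norm w)"
  have "((\<lambda>x. F (a + x)) has_derivative blinfun_apply (F' (a + x))) (at x)"
    by (rule has_derivative_eq_rhs[OF has_derivative_compose[OF _ deriv]])
       (auto intro!: derivative_eq_intros)
  then have "((\<lambda>v. F (a + v) - F a - F' a v) has_derivative (\<lambda>h. F' (a + x) h - 0 - F' a h)) (at x)"
    by (intro has_derivative_diff has_derivative_const bounded_linear_imp_has_derivative
        blinfun.bounded_linear_right)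
  then show "((\<lambda>v. F (a + v) - F a - F' a v) has_derivative blinfun_apply (F' (a + x) - F' a)) (at x)"
    by (simp add: blinfun.diff_left[abs_def])
  have "norm (F' (a + x) - F' a) \<le> C * norm x" using lip[of "a + x" a] by simp
  also have "\<dots> \<le> C * (norm v + norm w)" using x \<open>C \<ge> 0\<close> by (intro mult_left_mono) auto
  finally show "norm (F' (a + x) - F' a) \<le> C * (norm v + norm w)" .
qed auto

text \<open>Moving the base point of a first order Taylor remainder: the difference is differentiated along
  the increment \<open>v\<close>, where only second differences of \<open>F'\<close> appear. Differentiating in the base point
  instead would call for the symmetry of the second derivative.\<close>

lemma taylor_remainder_base_point:
  fixes F :: "'a::real_normed_vector \<Rightarrow> 'b::real_normed_vector"
    and F' :: "'a \<Rightarrow> 'a \<Rightarrow>\<^sub>L 'b" and F'' :: "'a \<Rightarrow> 'a \<Rightarrow>\<^sub>L 'a \<Rightarrow>\<^sub>L 'b"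
  assumes deriv: "\<And>x. (F has_derivative blinfun_apply (F' x)) (at x)"
    and deriv': "\<And>x. (F' has_derivative blinfun_apply (F'' x)) (at x)"
    and lip: "\<And>x y. norm (F'' x - F'' y) \<le> C * norm (x - y)" and "C \<ge> 0"
  shows "norm ((F (a + v) - F a - F' a v) - (F (c + v) - F c - F' c v))
         \<le> C * norm (a - c) * (norm v)\<^sup>2"
proof -
  let ?f = "\<lambda>w. (F (a + w) - F a - F' a w) - (F (c + w) - F c - F' c w)"
  have "norm (?f v - ?f 0) \<le> C * norm v * norm (a - c) * norm (v - 0)"
  proof (rule norm_diff_le_of_derivative_bound[of "cball 0 (norm v)" ?f
      "\<lambda>w. (F' (a + w) - F' a) - (F' (c + w) - F' c)"])
    fix x :: 'a assume x: "x \<in> cball 0 (norm v)"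
    have *: "((\<lambda>x. F (p + x)) has_derivative blinfun_apply (F' (p + x))) (at x)" for p
      by (rule has_derivative_eq_rhs[OF has_derivative_compose[OF _ deriv]])
         (auto intro!: derivative_eq_intros)
    have "(?f has_derivative (\<lambda>h. (F' (a + x) h - 0 - F' a h) - (F' (c + x) h - 0 - F' c h))) (at x)"
      by (intro has_derivative_diff has_derivative_const bounded_linear_imp_has_derivative
          blinfun.bounded_linear_right *)
    then show "(?f has_derivative blinfun_apply ((F' (a + x) - F' a) - (F' (c + x) - F' c))) (at x)"
      by (simp add: blinfun.diff_left[abs_def])
    have "norm ((F' (a + x) - F' a) - (F' (c + x) - F' c)) \<le> C * norm x * norm (a - c)"
      using four_point_shift[of F' F'', OF deriv' lip] .
    also have "\<dots> \<le> C * norm v * norm (a - c)"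
      using x \<open>C \<ge> 0\<close> by (intro mult_left_mono mult_right_mono) auto
    finally show "norm ((F' (a + x) - F' a) - (F' (c + x) - F' c)) \<le> C * norm v * norm (a - c)" .
  qed auto
  then show ?thesis by (simp add: power2_eq_square mult_ac)
qed

lemma four_point_bound_mono:
  assumes "four_point_bound C F" and "C \<le> C'" shows "four_point_bound C' F"
proof -
  have *: "N \<le> C' * x" if "N \<le> C * x" "x \<ge> 0" for N x
    using that mult_right_mono[OF assms(2) that(2)] by linarith
  show ?thesis
    using assms unfolding four_point_bound_def by (auto intro!: * intro: order_trans)
qed

lemma four_point_bound_linear:
  assumes L: "bounded_linear L" and F: "four_point_bound C F"
  shows "\<exists>C'. four_point_bound C' (\<lambda>x. L (F x))"
proof -
  interpret bounded_linear L by fact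
  obtain k where k: "k \<ge> 0" "\<And>x. norm (L x) \<le> norm x * k" using nonneg_bounded by blast
  have *: "norm (L u) \<le> (C * k) * x" if "norm u \<le> C * x" for u x
    using order_trans[OF k(2) mult_right_mono[OF that \<open>k \<ge> 0\<close>]] by (simp add: mult_ac)
  have "four_point_bound (C * k) (\<lambda>x. L (F x))"
    using F *[where x = 1] unfolding four_point_bound_def diff[symmetric] by (auto intro!: *)
  then show ?thesis ..
qed

text \<open>Discrete product rule: each of the four terms in the expansion carries one difference that is
  controlled by the bound for \<open>F\<close> or \<open>G\<close>.\<close>

lemma four_point_bound_product:
  fixes F :: "'x::real_normed_vector \<Rightarrow> 'a::real_normed_vector"
    and G :: "'x \<Rightarrow> 'b::real_normed_vector"
    and op :: "'a \<Rightarrow> 'b \<Rightarrow> 'c::real_normed_vector"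
  assumes op: "bounded_bilinear op" and F: "four_point_bound C F" and G: "four_point_bound C G"
  shows "\<exists>C'. four_point_bound C' (\<lambda>x. op (F x) (G x))"
proof -
  interpret bounded_bilinear op by fact
  obtain k where k: "k \<ge> 0" "\<And>x y. norm (op x y) \<le> norm x * norm y * k" using nonneg_bounded by blast
  have C: "C \<ge> 0" using F norm_ge_zero order_trans unfolding four_point_bound_def by blast
  note F' = F[unfolded four_point_bound_def, THEN conjunct1, rule_format]
    F[unfolded four_point_bound_def, THEN conjunct2, THEN conjunct1, rule_format]
    F[unfolded four_point_bound_def, THEN conjunct2, THEN conjunct2, rule_format]
  note G' = G[unfolded four_point_bound_def, THEN conjunct1, rule_format]
    G[unfolded four_point_bound_def, THEN conjunct2, THEN conjunct1, rule_format]
    G[unfolded four_point_bound_def, THEN conjunct2, THEN conjunct2, rule_format]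
  have *: "norm (op u v) \<le> (C * C * k) * (x * y)"
    if "norm u \<le> C * x" "norm v \<le> C * y" for u v x y
  proof -
    have "norm (op u v) \<le> norm u * norm v * k" by (rule k)
    also have "\<dots> \<le> (C * x) * (C * y) * k"
      using that k C by (intro mult_right_mono mult_mono) (auto intro: order_trans[OF norm_ge_zero])
    finally show ?thesis by (simp add: mult_ac)
  qed
  define K where "K = C * C * k"
  have K: "K \<ge> 0" using C k by (simp add: K_def)
  have "four_point_bound (4 * K) (\<lambda>x. op (F x) (G x))"
    unfolding four_point_bound_def
  proof (intro conjI allI)
    fix x y
    show "norm (op (F x) (G x)) \<le> 4 * K"
      using *[of "F x" 1 "G x" 1] F'(1)[of x] G'(1)[of x] K by (simp add: K_def)
    have "norm (op (F x - F y) (G x) + op (F y) (G x - G y)) \<le> K * (norm (x - y) * 1) + K * (1 * norm (x - y))"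
      unfolding K_def by (intro norm_triangle_mono *) (use F' G' in auto)
    also have "op (F x - F y) (G x) + op (F y) (G x - G y) = op (F x) (G x) - op (F y) (G y)"
      by (simp add: diff_left diff_right)
    finally show "norm (op (F x) (G x) - op (F y) (G y)) \<le> 4 * K * norm (x - y)"
      using mult_nonneg_nonneg[OF K norm_ge_zero[of "x - y"]] by simp
  next
    fix a a' c c' :: 'x
    define Q where "Q = norm ((a' - a) - (c' - c)) + (norm (a - c) + norm (a' - c')) * (norm (a' - a) + norm (c' - c))"
    have Q: "norm (c' - c) * norm (a' - c') \<le> Q" "norm (a - c) * norm (a' - a) \<le> Q"
      unfolding Q_def by (auto simp: algebra_simps intro!: add_nonneg_nonneg)
    have Q0: "0 \<le> Q" unfolding Q_def by simp
    have "norm (op ((F a' - F a) - (F c' - F c)) (G a') + op (F c' - F c) (G a' - G c')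
        + op (F a - F c) (G a' - G a) + op (F c) ((G a' - G a) - (G c' - G c)))
      \<le> K * (Q * 1) + K * (norm (c' - c) * norm (a' - c'))
        + K * (norm (a - c) * norm (a' - a)) + K * (1 * Q)"
      unfolding K_def Q_def by (intro norm_triangle_mono * F' G') (use F'(1) G'(1) in auto)
    also have "\<dots> \<le> K * (Q * 1) + K * Q + K * Q + K * (1 * Q)"
      using Q Q0 K by (intro add_mono mult_left_mono) auto
    also have "op ((F a' - F a) - (F c' - F c)) (G a') + op (F c' - F c) (G a' - G c')
        + op (F a - F c) (G a' - G a) + op (F c) ((G a' - G a) - (G c' - G c))
       = op (F a') (G a') - op (F a) (G a) - (op (F c') (G c') - op (F c) (G c))"
      by (simp only: diff_left diff_right) (simp add: algebra_simps)
    finally show "norm (op (F a') (G a') - op (F a) (G a) - (op (F c') (G c') - op (F c) (G c)))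
      \<le> 4 * K * (norm ((a' - a) - (c' - c)) + (norm (a - c) + norm (a' - c')) * (norm (a' - a) + norm (c' - c)))"
      unfolding Q_def[symmetric] by simp
  qed
  then show ?thesis ..
qed

section \<open>The coefficients of the equation\<close>

lemma Dg_g_add: "Dg_g g y (M + N) = Dg_g g y M + Dg_g g y N"
  by (simp add: Dg_g_def scaleR_left.add sum.distrib)

lemma Dg_g_diff: "Dg_g g y (M - N) = Dg_g g y M - Dg_g g y N"
  by (simp add: Dg_g_def scaleR_left.diff sum_subtractf)

lemma bounded_linear_column: "bounded_linear (column i :: real^'n^'m \<Rightarrow> real^'m)"
  by (rule linear_conv_bounded_linear[THEN iffD1])
     (auto simp: linear_iff column_def vec_eq_iff)

text \<open>This is the identity that makes the relation of Chen useful: on a pure tensor, the second order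
  coefficient is the derivative of \<open>g\<close> in the direction \<open>g y *v u\<close>.\<close>

lemma Dg_g_outer:
  fixes g :: "real^'m \<Rightarrow> real^'d^'m"
  assumes "(g has_derivative D) (at y)"
  shows "Dg_g g y (outer u v) = D (g y *v u) *v v"
proof -
  have D: "frechet_derivative g (at y) = D" using frechet_derivative_at[OF assms] by simp
  interpret D: linear D using assms has_derivative_linear by blast
  have "D (g y *v u) *v v = (\<Sum>j\<in>UNIV. v $ j *\<^sub>R column j (\<Sum>i\<in>UNIV. u $ i *\<^sub>R D (column i (g y))))"
    unfolding matrix_mult_sum[of "g y"] matrix_mult_sum[of "D _"]
    by (simp add: scalar_mult_eq_scaleR D.sum D.scaleR)
  also have "\<dots> = (\<Sum>j\<in>UNIV. \<Sum>i\<in>UNIV. (u $ i * v $ j) *\<^sub>R column j (D (column i (g y))))"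
    by (simp add: bounded_linear.linear[OF bounded_linear_column] linear_sum linear_scale scaleR_sum_right mult.commute)
  also have "\<dots> = Dg_g g y (outer u v)"
    unfolding Dg_g_def D outer_def by (subst sum.swap) simp
  finally show ?thesis ..
qed


lemma four_point_bound_scaleR:
  assumes "four_point_bound C F" and "\<bar>k\<bar> \<le> m"
  shows "four_point_bound (C * m) (\<lambda>x. k *\<^sub>R F x)"
proof -
  have *: "norm (k *\<^sub>R u) \<le> (C * m) * x" if "norm u \<le> C * x" for u :: 'b and x
  proof -
    have "norm (k *\<^sub>R u) \<le> m * (C * x)"
      using assms(2) that by (auto intro!: mult_mono intro: order_trans[OF abs_ge_zero])
    then show ?thesis by (simp add: mult_ac)
  qed
  show ?thesis
    using assms(1) unfolding four_point_bound_def scaleR_diff_right[symmetric]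
    apply (intro conjI allI)
    subgoal for x using *[of "F x" 1] by simp
    subgoal for x y by (rule *) auto
    subgoal for a a' c c' by (rule *) auto
    done
qed

lemma four_point_bound_add:
  assumes "four_point_bound C F" and "four_point_bound C' G"
  shows "four_point_bound (C + C') (\<lambda>x. F x + G x)"
proof -
  have *: "norm w \<le> (C + C') * x" if "norm u \<le> C * x" "norm v \<le> C' * x" "w = u + v" for u v w :: 'b and x
    using norm_triangle_ineq[of u v] that by (simp add: distrib_right)
  show ?thesis
    using assms unfolding four_point_bound_def
    apply (intro conjI allI)
    subgoal for x using *[of "F x" 1 "G x"] by simp
    subgoal for x y by (rule *[of "F x - F y" _ "G x - G y"]) auto
    subgoal for a a' c c' by (rule *[of "F a' - F a - (F c' - F c)" _ "G a' - G a - (G c' - G c)"]) auto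
    done
qed

lemma four_point_bound_sum:
  assumes "finite I" and "\<And>i. i \<in> I \<Longrightarrow> four_point_bound (c i) (F i)"
  shows "four_point_bound (\<Sum>i\<in>I. c i) (\<lambda>x. \<Sum>i\<in>I. F i x)"
  using assms
proof (induction I rule: finite_induct)
  case empty
  then show ?case by (simp add: four_point_bound_def)
next
  case (insert i I)
  then show ?case by (simp add: four_point_bound_add)
qed

text \<open>The second order coefficient contains \<open>Dg\<close> as a factor, so three bounded derivatives of \<open>g\<close>
  leave it with exactly the regularity that is needed to compare two solutions.\<close>

lemma four_point_bound_Dg_g:
  fixes g :: "real^'m \<Rightarrow> real^'d^'m" and D :: "real^'m \<Rightarrow> (real^'m) \<Rightarrow>\<^sub>L (real^'d^'m)"
  assumes deriv: "\<And>x. (g has_derivative blinfun_apply (D x)) (at x)"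
    and g: "four_point_bound C g" and D: "four_point_bound C D"
  shows "\<exists>C'. \<forall>M. four_point_bound (C' * norm M) (\<lambda>y. Dg_g g y M)"
proof -
  have "\<exists>c. four_point_bound c (\<lambda>y. column j (D y (column i (g y))))" for i j
  proof -
    obtain c1 where "four_point_bound c1 (\<lambda>y. column i (g y))"
      using four_point_bound_linear[OF bounded_linear_column g] by blast
    then have "four_point_bound (max c1 C) (\<lambda>y. column i (g y))" "four_point_bound (max c1 C) D"
      using D by (auto intro: four_point_bound_mono)
    then obtain c2 where "four_point_bound c2 (\<lambda>y. D y (column i (g y)))"
      using four_point_bound_product[OF bounded_bilinear_blinfun_apply] by blast
    then show ?thesis using four_point_bound_linear[OF bounded_linear_column] by blast
  qed
  note ex = this
  define c where "c i j = (SOME c. four_point_bound c (\<lambda>y. column j (D y (column i (g y)))))" for i j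
  have c: "four_point_bound (c i j) (\<lambda>y. column j (D y (column i (g y))))" for i j
    unfolding c_def by (rule someI_ex[OF ex])
  have entry: "\<bar>M $ i $ j\<bar> \<le> norm M" for M :: "real^'d^'d" and i j
    using component_le_norm_cart[of "M $ i" j] Finite_Cartesian_Product.norm_nth_le[of M i] by linarith
  have Dg_g_eq: "Dg_g g y M = (\<Sum>i\<in>UNIV. \<Sum>j\<in>UNIV. M $ i $ j *\<^sub>R column j (D y (column i (g y))))" for y M
    unfolding Dg_g_def frechet_derivative_at[OF deriv, symmetric] ..
  have "four_point_bound ((\<Sum>i\<in>UNIV. \<Sum>j\<in>UNIV. c i j) * norm M) (\<lambda>y. Dg_g g y M)" for M
  proof -
    have "four_point_bound (\<Sum>i\<in>UNIV. \<Sum>j\<in>UNIV. c i j * norm M)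
       (\<lambda>y. \<Sum>i\<in>UNIV. \<Sum>j\<in>UNIV. M $ i $ j *\<^sub>R column j (D y (column i (g y))))"
      by (rule four_point_bound_sum[OF finite], rule four_point_bound_sum[OF finite])
         (rule four_point_bound_scaleR[OF c entry])
    then show ?thesis
      by (simp add: Dg_g_eq sum_distrib_right)
  qed
  then show ?thesis by blast
qed

text \<open>All the properties of the coefficients share one constant \<open>K \<ge> 1\<close>, which also dominates the
  constant of the sewing lemma for the exponent \<open>3 \<beta>\<close>. Later estimates are then polynomials in \<open>K\<close>,
  and \<open>K\<close> may be enlarged to absorb bounds on the driving paths and on the solutions.\<close>

locale rde_field =
  fixes \<beta> K :: real and g :: "real^'m \<Rightarrow> real^'d^'m"
    and D :: "real^'m \<Rightarrow> (real^'m) \<Rightarrow>\<^sub>L (real^'d^'m)" and b :: "real^'m \<Rightarrow> real^'m"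
  assumes beta: "1 / 3 < \<beta>" "\<beta> < 1 / 2" and K_ge_1: "1 \<le> K"
    and K_sewing: "1 / (1 - 2 powr (1 - 3 * \<beta>)) \<le> K"
    and g_bound: "four_point_bound K g" and D_bound: "four_point_bound K D"
    and Dg_g_bound: "four_point_bound (K * norm M) (\<lambda>y. Dg_g g y M)"
    and Dg_g_tensor: "Dg_g g x (outer \<xi> \<zeta>) = D x (g x *v \<xi>) *v \<zeta>"
    and taylor_increment: "norm ((g (a + v) - g a - D a v) - (g (a + w) - g a - D a w))
           \<le> K * (norm v + norm w) * norm (v - w)"
    and taylor_base_point: "norm ((g (a + v) - g a - D a v) - (g (c + v) - g c - D c v))
           \<le> K * norm (a - c) * (norm v)\<^sup>2"
    and b_lipschitz: "norm (b x - b y) \<le> K * norm (x - y)" and b_0: "norm (b 0) \<le> K"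

lemma rde_field_mono:
  assumes "rde_field \<beta> K g D b" and "K \<le> K'"
  shows "rde_field \<beta> K' g D b"
proof -
  interpret rde_field \<beta> K g D b by fact
  have *: "N \<le> K' * x" if "N \<le> K * x" "x \<ge> 0" for N x
    using that mult_right_mono[OF assms(2) that(2)] by linarith
  show ?thesis
  proof
    show "norm ((g (a + v) - g a - D a v) - (g (a + w) - g a - D a w))
           \<le> K' * (norm v + norm w) * norm (v - w)" for a v w
      unfolding mult.assoc by (rule *) (use taylor_increment[of a v w] in \<open>auto simp: mult.assoc\<close>)
    show "norm ((g (a + v) - g a - D a v) - (g (c + v) - g c - D c v))
           \<le> K' * norm (a - c) * (norm v)\<^sup>2" for a c v
      unfolding mult.assoc by (rule *) (use taylor_base_point[of a v c] in \<open>auto simp: mult.assoc\<close>)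
    show "four_point_bound (K' * norm M) (\<lambda>y. Dg_g g y M)" for M
      by (rule four_point_bound_mono[OF Dg_g_bound]) (use assms(2) in \<open>auto intro: mult_right_mono\<close>)
  qed (use assms beta K_ge_1 K_sewing four_point_bound_mono[OF g_bound] four_point_bound_mono[OF D_bound]
    Dg_g_tensor b_0 in \<open>auto intro: * b_lipschitz\<close>)
qed

lemma rde_field_exists:
  fixes g :: "real^'m \<Rightarrow> real^'d^'m"
  assumes beta: "1 / 3 < \<beta>" "\<beta> < 1 / 2" and g: "C3_bounded g"
    and b: "\<And>x y. norm (b x - b y) \<le> L * norm (x - y)"
  shows "\<exists>K D. rde_field \<beta> K g D b"
proof -
  obtain D1 D2 D3 where
    d1: "\<And>x. (g has_derivative blinfun_apply (D1 x)) (at x)" and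
    d2: "\<And>x. (D1 has_derivative blinfun_apply (D2 x)) (at x)" and
    d3: "\<And>x. (D2 has_derivative blinfun_apply (D3 x)) (at x)" and
    bd: "bounded (range g)" "bounded (range D1)" "bounded (range D2)" "bounded (range D3)"
    using g unfolding C3_bounded_def by blast
  obtain c0 c1 c2 c3 where c: "\<And>x. norm (g x) \<le> c0" "\<And>x. norm (D1 x) \<le> c1"
    "\<And>x. norm (D2 x) \<le> c2" "\<And>x. norm (D3 x) \<le> c3"
    using bd unfolding bounded_iff by (metis rangeI)
  define C where "C = Max {1, c0, c1, c2, c3, L, norm (b 0), 1 / (1 - 2 powr (1 - 3 * \<beta>))}"
  have C_ge: "1 \<le> C" "c0 \<le> C" "c1 \<le> C" "c2 \<le> C" "c3 \<le> C" "L \<le> C" "norm (b 0) \<le> C"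
    "1 / (1 - 2 powr (1 - 3 * \<beta>)) \<le> C"
    unfolding C_def by (rule Max_ge; simp)+
  have bds: "norm (g x) \<le> C" "norm (D1 x) \<le> C" "norm (D2 x) \<le> C" "norm (D3 x) \<le> C" for x
    using c[of x] C_ge by linarith+
  have lip1: "norm (D1 x - D1 y) \<le> C * norm (x - y)" for x y
    by (rule norm_diff_le_of_derivative_bound[of UNIV D1 D2]) (use d2 bds in auto)
  have lip2: "norm (D2 x - D2 y) \<le> C * norm (x - y)" for x y
    by (rule norm_diff_le_of_derivative_bound[of UNIV D2 D3]) (use d3 bds in auto)
  have fg: "four_point_bound C g" by (rule four_point_boundI[OF bds(1) d1 bds(2) lip1])
  have fD: "four_point_bound C D1" by (rule four_point_boundI[OF bds(2) d2 bds(3) lip2])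
  obtain C' where C': "\<And>M. four_point_bound (C' * norm M) (\<lambda>y. Dg_g g y M)"
    using four_point_bound_Dg_g[OF d1 fg fD] by blast
  define K where "K = max C C'"
  have K: "C \<le> K" "C' \<le> K" by (auto simp: K_def)
  then have "0 \<le> C" "0 \<le> K" using C_ge by auto
  have *: "N \<le> K * x" if "N \<le> C * x" "x \<ge> 0" for N x
    using that mult_right_mono[OF K(1) that(2)] by linarith
  have "rde_field \<beta> K g D1 b"
  proof
    show "norm ((g (a + v) - g a - D1 a v) - (g (a + w) - g a - D1 a w))
           \<le> K * (norm v + norm w) * norm (v - w)" for a v w
      unfolding mult.assoc
      by (rule *) (use taylor_remainder_lipschitz[OF d1 lip1 \<open>0 \<le> C\<close>, of a v w] in \<open>auto simp: mult.assoc\<close>)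
    show "norm ((g (a + v) - g a - D1 a v) - (g (c + v) - g c - D1 c v))
           \<le> K * norm (a - c) * (norm v)\<^sup>2" for a c v
      unfolding mult.assoc
      by (rule *) (use taylor_remainder_base_point[OF d1 d2 lip2 \<open>0 \<le> C\<close>, of a v c] in \<open>auto simp: mult.assoc\<close>)
    show "four_point_bound (K * norm M) (\<lambda>y. Dg_g g y M)" for M
      by (rule four_point_bound_mono[OF C']) (use K in \<open>auto intro: mult_right_mono\<close>)
    show "norm (b x - b y) \<le> K * norm (x - y)" for x y
      using b[of x y] mult_right_mono[of L K "norm (x - y)"] C_ge K by force
  qed (use beta C_ge K four_point_bound_mono[OF fg] four_point_bound_mono[OF fD]
    Dg_g_outer[OF d1] in auto)
  then show ?thesis by blast
qed

section \<open>Bounds on increments by powers of the time scale\<close>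

text \<open>All scales are powers of \<open>(t - s) powr \<beta>\<close>: increments of paths have \<open>n = 1\<close>, second levels and
  remainders have \<open>n = 2\<close>, defects of germs have \<open>n = 3\<close>. Unlike the Hoelder seminorms, the predicate
  includes \<open>s = t\<close>.\<close>

definition incr_bound ::
  "real \<Rightarrow> nat \<Rightarrow> real \<Rightarrow> real \<Rightarrow> (real \<Rightarrow> real \<Rightarrow> 'a::real_normed_vector) \<Rightarrow> real \<Rightarrow> bool" where
  "incr_bound \<beta> n a e F C \<longleftrightarrow>
     (\<forall>s t. a \<le> s \<longrightarrow> s \<le> t \<longrightarrow> t \<le> e \<longrightarrow> norm (F s t) \<le> C * ((t - s) powr \<beta>) ^ n)"

lemma incr_boundD:
  "incr_bound \<beta> n a e F C \<Longrightarrow> a \<le> s \<Longrightarrow> s \<le> t \<Longrightarrow> t \<le> e \<Longrightarrow> norm (F s t) \<le> C * ((t - s) powr \<beta>) ^ n"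
  by (simp add: incr_bound_def)

lemma incr_bound_mono:
  assumes "incr_bound \<beta> n a e F C" and "C \<le> C'" shows "incr_bound \<beta> n a e F C'"
  using assms unfolding incr_bound_def by (meson mult_right_mono order_trans powr_ge_zero zero_le_power)

lemma incr_bound_subinterval:
  "incr_bound \<beta> n a e F C \<Longrightarrow> a \<le> a' \<Longrightarrow> e' \<le> e \<Longrightarrow> incr_bound \<beta> n a' e' F C"
  by (simp add: incr_bound_def)

text \<open>If any bound \<open>\<rho>\<close> can be improved to \<open>A + \<rho> / 2\<close>, then iteration drives every finite bound
  down to the fixed point \<open>2 * A\<close>. This is how an estimate that contains its own left side, with a small
  factor, becomes unconditional.\<close>

lemma incr_bound_absorb:
  assumes "incr_bound \<beta> n a e F \<rho>0" and "A \<ge> 0"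
    and improve: "\<And>\<rho>. \<rho> \<ge> 0 \<Longrightarrow> incr_bound \<beta> n a e F \<rho> \<Longrightarrow> incr_bound \<beta> n a e F (A + \<rho> / 2)"
  shows "incr_bound \<beta> n a e F (2 * A)"
proof -
  define \<rho>1 where "\<rho>1 = max \<rho>0 0"
  have iter: "incr_bound \<beta> n a e F (2 * A + \<rho>1 / 2 ^ k)" for k
  proof (induction k)
    case 0
    then show ?case
      by (rule incr_bound_mono[OF assms(1)]) (use \<open>A \<ge> 0\<close> in \<open>auto simp: \<rho>1_def\<close>)
  next
    case (Suc k)
    have "0 \<le> 2 * A + \<rho>1 / 2 ^ k" using \<open>A \<ge> 0\<close> by (simp add: \<rho>1_def)
    from improve[OF this Suc] show ?case by (simp add: field_simps)
  qed
  show ?thesis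
    unfolding incr_bound_def
  proof (intro allI impI)
    fix s t assume st: "a \<le> s" "s \<le> t" "t \<le> e"
    have "(\<lambda>k. (2 * A + \<rho>1 * (1/2) ^ k) * ((t - s) powr \<beta>) ^ n) \<longlonglongrightarrow> (2 * A + \<rho>1 * 0) * ((t - s) powr \<beta>) ^ n"
      by (intro tendsto_intros LIMSEQ_realpow_zero) auto
    moreover have "norm (F s t) \<le> (2 * A + \<rho>1 * (1/2) ^ k) * ((t - s) powr \<beta>) ^ n" for k
      using incr_boundD[OF iter st] by (simp add: power_divide)
    ultimately show "norm (F s t) \<le> 2 * A * ((t - s) powr \<beta>) ^ n"
      by (intro LIMSEQ_le_const[of _ "2 * A * ((t - s) powr \<beta>) ^ n"]) auto
  qed
qed

lemma continuous_on_incr_bound: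
  assumes "\<beta> > 0" and y: "incr_bound \<beta> 1 a e (incr y) C"
  shows "continuous_on {a..e} y"
  unfolding continuous_on_def
proof
  fix x assume x: "x \<in> {a..e}"
  have le: "norm (y t - y x) \<le> C * \<bar>t - x\<bar> powr \<beta>" if "t \<in> {a..e}" for t
    using incr_boundD[OF y, of x t] incr_boundD[OF y, of t x] x that
    by (cases "x \<le> t") (auto simp: incr_def norm_minus_commute abs_if)
  have "((\<lambda>t. \<bar>t - x\<bar> powr \<beta>) \<longlongrightarrow> 0) (at x within {a..e})"
    using \<open>\<beta> > 0\<close> by (intro tendsto_zero_powrI[where b = \<beta>]) (auto intro!: tendsto_eq_intros)
  then have "((\<lambda>t. C * \<bar>t - x\<bar> powr \<beta>) \<longlongrightarrow> 0) (at x within {a..e})"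
    using tendsto_mult_right_zero by blast
  then have "((\<lambda>t. y t - y x) \<longlongrightarrow> 0) (at x within {a..e})"
    by (rule Lim_null_comparison[rotated]) (auto simp: eventually_at_filter le)
  then show "(y \<longlongrightarrow> y x) (at x within {a..e})" using LIM_zero_iff by blast
qed

section \<open>Expansion of the remainder of a solution\<close>

definition chen_relation ::
  "real \<Rightarrow> real \<Rightarrow> (real \<Rightarrow> real^'d) \<Rightarrow> (real \<Rightarrow> real \<Rightarrow> real^'d^'d) \<Rightarrow> bool" where
  "chen_relation a e X XX \<longleftrightarrow> (\<forall>s u t. a \<le> s \<longrightarrow> s \<le> u \<longrightarrow> u \<le> t \<longrightarrow> t \<le> e \<longrightarrow>
     XX s t = XX s u + XX u t + outer (incr X s u) (incr X u t))"

text \<open>The compensated Riemann summand of the rough integral.\<close>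

definition germ ::
  "(real^'m \<Rightarrow> real^'d^'m) \<Rightarrow> (real \<Rightarrow> real^'d) \<Rightarrow> (real \<Rightarrow> real \<Rightarrow> real^'d^'d) \<Rightarrow> (real \<Rightarrow> real^'m)
    \<Rightarrow> real \<Rightarrow> real \<Rightarrow> real^'m" where
  "germ g X XX y u v = g (y u) *v incr X u v + Dg_g g (y u) (XX u v)"

text \<open>The integral equation alone, with the drift \<open>x \<mapsto> A *v x + f x\<close> abstracted to \<open>b\<close>.\<close>

definition rde_equation ::
  "(real^'m \<Rightarrow> real^'d^'m) \<Rightarrow> (real^'m \<Rightarrow> real^'m) \<Rightarrow> real \<Rightarrow> real
    \<Rightarrow> (real \<Rightarrow> real^'d) \<Rightarrow> (real \<Rightarrow> real \<Rightarrow> real^'d^'d) \<Rightarrow> (real \<Rightarrow> real^'m) \<Rightarrow> bool" where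
  "rde_equation g b a e X XX y \<longleftrightarrow> (\<forall>s t. a \<le> s \<longrightarrow> s < t \<longrightarrow> t \<le> e \<longrightarrow>
     (\<exists>J. ((\<lambda>ts. partition_sum ts (germ g X XX y)) \<longlongrightarrow> J) (fine_partitions s t) \<and>
          incr y s t = integral {s..t} (\<lambda>r. b (y r)) + J))"

lemma partition_sum_diff:
  fixes F G :: "real \<Rightarrow> real \<Rightarrow> 'a::ab_group_add"
  shows "partition_sum ts (\<lambda>u v. F u v - G u v) = partition_sum ts F - partition_sum ts G"
  by (simp add: partition_sum_def sum_subtractf)

lemma powr_scale_power: "n > 0 \<Longrightarrow> (x powr \<beta>) ^ n = x powr (real n * \<beta> :: real)"
  by (cases "x = 0") (simp_all add: powr_realpow[symmetric] powr_powr mult.commute)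

lemma powr_cube: "(x powr \<beta>) ^ 3 = x powr (3 * \<beta> :: real)"
  by (simp add: powr_scale_power)

context rde_field
begin

lemma K_nonneg: "0 \<le> K" using K_ge_1 by simp

lemmas g_le = g_bound[unfolded four_point_bound_def, THEN conjunct1, rule_format]
lemmas g_lip = g_bound[unfolded four_point_bound_def, THEN conjunct2, THEN conjunct1, rule_format]
lemmas D_le = D_bound[unfolded four_point_bound_def, THEN conjunct1, rule_format]
lemmas D_lip = D_bound[unfolded four_point_bound_def, THEN conjunct2, THEN conjunct1, rule_format]
lemmas Dg_g_le = Dg_g_bound[unfolded four_point_bound_def, THEN conjunct1, rule_format]
lemmas Dg_g_lip = Dg_g_bound[unfolded four_point_bound_def, THEN conjunct2, THEN conjunct1, rule_format]
lemmas Dg_g_four = Dg_g_bound[unfolded four_point_bound_def, THEN conjunct2, THEN conjunct2, rule_format]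

text \<open>The remainder of \<open>g \<circ> y\<close> as a path controlled by \<open>X\<close>, the Gubinelli derivative being
  \<open>Dg(y) g(y)\<close>.\<close>

definition field_remainder :: "(real \<Rightarrow> real^'d) \<Rightarrow> (real \<Rightarrow> real^'m) \<Rightarrow> real \<Rightarrow> real \<Rightarrow> real^'d^'m" where
  "field_remainder X y s u = g (y u) - g (y s) - D (y s) (g (y s) *v incr X s u)"

definition taylor_remainder :: "real^'m \<Rightarrow> real^'m \<Rightarrow> real^'d^'m" where
  "taylor_remainder a v = g (a + v) - g a - D a v"

lemma field_remainder_eq:
  "field_remainder X y s u =
     taylor_remainder (y s) (incr y s u) + D (y s) (remainder g X y s u)"
  by (simp add: field_remainder_def taylor_remainder_def remainder_def incr_def blinfun.diff_right)

text \<open>By the relation of Chen the second order term of the germ cancels the product of first order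
  increments. What is left is a remainder of second order times an increment of \<open>X\<close>, and an increment
  of the second order coefficient times the second level: both are of third order, hence
  summable because \<open>3 * \<beta> > 1\<close>.\<close>

lemma germ_defect:
  assumes "chen_relation a e X XX" and "a \<le> s" "s \<le> u" "u \<le> t" "t \<le> e"
  shows "germ g X XX y s t - germ g X XX y s u - germ g X XX y u t =
     - (field_remainder X y s u *v incr X u t
        + (Dg_g g (y u) (XX u t) - Dg_g g (y s) (XX u t)))"
proof -
  have "XX s t = XX s u + XX u t + outer (incr X s u) (incr X u t)"
    using assms unfolding chen_relation_def by blast
  moreover have "incr X s t = incr X s u + incr X u t" by (simp add: incr_def)
  ultimately show ?thesis
    by (simp add: germ_def field_remainder_def Dg_g_add Dg_g_tensor matrix_vector_right_distrib
        matrix_vector_mult_diff_rdistrib)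
qed

lemma sewing_cube:
  assumes "s < t" and "C \<ge> 0"
    and "\<And>x u v. s \<le> x \<Longrightarrow> x \<le> u \<Longrightarrow> u \<le> v \<Longrightarrow> v \<le> t \<Longrightarrow>
          norm (F x v - F x u - F u v) \<le> C * ((v - x) powr \<beta>) ^ 3"
    and "((\<lambda>ts. partition_sum ts F) \<longlongrightarrow> J) (fine_partitions s t)"
  shows "norm (J - F s t) \<le> K * C * ((t - s) powr \<beta>) ^ 3"
proof -
  have "norm (J - F s t) \<le> C * (t - s) powr (3 * \<beta>) / (1 - 2 powr (1 - 3 * \<beta>))"
    by (rule sewing_bound) (use assms beta in \<open>auto simp: powr_cube\<close>)
  also have "\<dots> = (1 / (1 - 2 powr (1 - 3 * \<beta>))) * (C * ((t - s) powr \<beta>) ^ 3)"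
    by (simp add: powr_cube)
  also have "\<dots> \<le> K * (C * ((t - s) powr \<beta>) ^ 3)"
    using assms(2) by (intro mult_right_mono K_sewing) auto
  finally show ?thesis by (simp add: mult.assoc)
qed

lemma remainder_expansion:
  assumes "rde_equation g b a e X XX y" and "a \<le> s" "s < t" "t \<le> e" and "C \<ge> 0"
    and "\<And>x u v. s \<le> x \<Longrightarrow> x \<le> u \<Longrightarrow> u \<le> v \<Longrightarrow> v \<le> t \<Longrightarrow>
          norm (germ g X XX y x v - germ g X XX y x u - germ g X XX y u v) \<le> C * ((v - x) powr \<beta>) ^ 3"
  shows "norm (remainder g X y s t - integral {s..t} (\<lambda>r. b (y r)) - Dg_g g (y s) (XX s t))
     \<le> K * C * ((t - s) powr \<beta>) ^ 3"
proof -
  obtain J where J: "((\<lambda>ts. partition_sum ts (germ g X XX y)) \<longlongrightarrow> J) (fine_partitions s t)"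
    "incr y s t = integral {s..t} (\<lambda>r. b (y r)) + J"
    using assms unfolding rde_equation_def by blast
  have "norm (J - germ g X XX y s t) \<le> K * C * ((t - s) powr \<beta>) ^ 3"
    by (rule sewing_cube) (use assms J in auto)
  then show ?thesis by (simp add: remainder_def J(2) germ_def algebra_simps)
qed

text \<open>The sewing lemma is applied to the difference of the two germs, so the error is governed by the
  difference of their defects and not by each defect separately.\<close>

lemma remainder_difference_expansion:
  assumes "rde_equation g b a e X XX y" and "rde_equation g b a e X' XX' z"
    and "a \<le> s" "s < t" "t \<le> e" and "C \<ge> 0"
    and defect: "\<And>x u v. s \<le> x \<Longrightarrow> x \<le> u \<Longrightarrow> u \<le> v \<Longrightarrow> v \<le> t \<Longrightarrow>
          norm ((germ g X' XX' z x v - germ g X' XX' z x u - germ g X' XX' z u v)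
            - (germ g X XX y x v - germ g X XX y x u - germ g X XX y u v)) \<le> C * ((v - x) powr \<beta>) ^ 3"
  shows "norm ((remainder g X' z s t - integral {s..t} (\<lambda>r. b (z r)) - Dg_g g (z s) (XX' s t))
     - (remainder g X y s t - integral {s..t} (\<lambda>r. b (y r)) - Dg_g g (y s) (XX s t)))
     \<le> K * C * ((t - s) powr \<beta>) ^ 3"
proof -
  obtain J where J: "((\<lambda>ts. partition_sum ts (germ g X XX y)) \<longlongrightarrow> J) (fine_partitions s t)"
    "incr y s t = integral {s..t} (\<lambda>r. b (y r)) + J"
    using assms unfolding rde_equation_def by blast
  obtain J' where J': "((\<lambda>ts. partition_sum ts (germ g X' XX' z)) \<longlongrightarrow> J') (fine_partitions s t)"
    "incr z s t = integral {s..t} (\<lambda>r. b (z r)) + J'"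
    using assms unfolding rde_equation_def by blast
  have "norm ((J' - J) - (germ g X' XX' z s t - germ g X XX y s t)) \<le> K * C * ((t - s) powr \<beta>) ^ 3"
  proof (rule sewing_cube[where F = "\<lambda>u v. germ g X' XX' z u v - germ g X XX y u v"])
    show "((\<lambda>ts. partition_sum ts (\<lambda>u v. germ g X' XX' z u v - germ g X XX y u v)) \<longlongrightarrow> J' - J) (fine_partitions s t)"
      unfolding partition_sum_diff by (intro tendsto_diff J J')
    show "norm (germ g X' XX' z x v - germ g X XX y x v - (germ g X' XX' z x u - germ g X XX y x u) -
               (germ g X' XX' z u v - germ g X XX y u v)) \<le> C * ((v - x) powr \<beta>) ^ 3"
      if "s \<le> x" "x \<le> u" "u \<le> v" "v \<le> t" for x u v
      using defect[OF that] by (simp add: algebra_simps)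
  qed (use assms in auto)
  then show ?thesis by (simp add: remainder_def J(2) J'(2) germ_def algebra_simps)
qed

text \<open>The last bound lets the drift be treated as a second order term, since \<open>2 * \<beta> < 1\<close>.\<close>

lemma scale_facts:
  assumes "c \<le> s" "s \<le> t" "t \<le> e" "e - c \<le> 1"
  shows "0 \<le> (t - s) powr \<beta>" "(t - s) powr \<beta> \<le> (e - c) powr \<beta>" "t - s \<le> ((t - s) powr \<beta>)\<^sup>2"
proof -
  show "0 \<le> (t - s) powr \<beta>" by simp
  show "(t - s) powr \<beta> \<le> (e - c) powr \<beta>" using assms beta by (intro powr_mono2) auto
  have "t - s = (t - s) powr 1" using assms by simp
  also have "\<dots> \<le> (t - s) powr (2 * \<beta>)" using assms beta by (intro powr_mono') auto
  also have "\<dots> = ((t - s) powr \<beta>)\<^sup>2" by (simp add: power2_eq_square powr_add[symmetric])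
  finally show "t - s \<le> ((t - s) powr \<beta>)\<^sup>2" .
qed

lemma norm_g_mult_le: "norm (g x *v \<xi>) \<le> K * norm \<xi>"
  using norm_matrix_vector_mult_le[of "g x" \<xi>] g_le[of x] mult_right_mono[of "norm (g x)" K "norm \<xi>"] by auto

lemma norm_D_apply_le: "norm (D x v) \<le> K * norm v"
  using norm_blinfun[of "D x" v] D_le[of x] mult_right_mono[of "norm (D x)" K "norm v"] by auto

lemma continuous_b: "continuous_on UNIV b"
  by (rule lipschitz_on_continuous_on[of K])
     (use b_lipschitz K_nonneg in \<open>auto simp: lipschitz_on_def dist_norm\<close>)

lemma drift_integral_le:
  assumes "continuous_on {s..t} y" and "s \<le> t" and "\<And>r. r \<in> {s..t} \<Longrightarrow> norm (y r) \<le> Z"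
  shows "norm (integral {s..t} (\<lambda>r. b (y r))) \<le> K * (1 + Z) * (t - s)"
proof -
  have "norm (b (y r)) \<le> K * (1 + Z)" if "r \<in> {s..t}" for r
  proof -
    have "norm (b (y r)) \<le> norm (b 0) + norm (b (y r) - b 0)"
      using norm_triangle_sub by blast
    also have "\<dots> \<le> K + K * norm (y r)" using b_0 b_lipschitz[of "y r" 0] by simp
    also have "\<dots> \<le> K + K * Z" using assms(3)[OF that] K_nonneg by (simp add: mult_left_mono)
    finally show ?thesis by (simp add: distrib_left)
  qed
  then show ?thesis
    using assms continuous_on_compose2[OF continuous_b assms(1)]
    by (intro integral_bound) auto
qed

lemma drift_integral_difference_le:
  assumes "continuous_on {s..t} y" and "continuous_on {s..t} z" and "s \<le> t"
    and "\<And>r. r \<in> {s..t} \<Longrightarrow> norm (z r - y r) \<le> \<nu>"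
  shows "norm (integral {s..t} (\<lambda>r. b (z r)) - integral {s..t} (\<lambda>r. b (y r))) \<le> K * \<nu> * (t - s)"
proof -
  have c: "continuous_on {s..t} (\<lambda>r. b (z r))" "continuous_on {s..t} (\<lambda>r. b (y r))"
    using assms continuous_on_compose2[OF continuous_b] by auto
  have "norm (b (z r) - b (y r)) \<le> K * \<nu>" if "r \<in> {s..t}" for r
    using b_lipschitz[of "z r" "y r"] mult_left_mono[OF assms(4)[OF that] K_nonneg] by linarith
  then have "norm (integral {s..t} (\<lambda>r. b (z r) - b (y r))) \<le> K * \<nu> * (t - s)"
    using assms c by (intro integral_bound) (auto intro: continuous_on_diff)
  then show ?thesis
    using c by (subst (asm) integral_diff) (auto intro: integrable_continuous_real)
qed

section \<open>A priori bound on a short window\<close>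

text \<open>If \<open>\<rho>\<close> bounds the remainder, then the expansion of the remainder bounds it by a constant plus a
  multiple of \<open>\<rho>\<close> times the largest scale of the window. The multiple is at most one half
  on a short window, so the bound can be absorbed. The result depends on the driving path only through
  \<open>K\<close> and on the solution only through its initial value, which makes it uniform over approximating paths.\<close>

lemma a_priori_bound:
  assumes ce: "e - c \<le> 1" and small: "62 * K ^ 7 * (e - c) powr \<beta> \<le> 1"
    and X: "incr_bound \<beta> 1 c e (incr X) K" and XX: "incr_bound \<beta> 2 c e XX K"
    and chen: "chen_relation c e X XX"
    and eq: "rde_equation g b c e X XX y"
    and R0: "incr_bound \<beta> 2 c e (remainder g X y) \<rho>0"
    and yc: "norm (y c) \<le> B"
  shows "incr_bound \<beta> 2 c e (remainder g X y) (2 * (K * (1 + B + K\<^sup>2) + K\<^sup>2 + 2 * K ^ 7))"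
proof (rule incr_bound_absorb[OF R0])
  have B: "0 \<le> B" using yc norm_ge_zero order_trans by blast
  note [simp] = K_nonneg
  show "0 \<le> K * (1 + B + K\<^sup>2) + K\<^sup>2 + 2 * K ^ 7" using B by simp
  fix \<rho> assume \<rho>: "0 \<le> \<rho>" and R: "incr_bound \<beta> 2 c e (remainder g X y) \<rho>"
  define \<kappa> where "\<kappa> = (e - c) powr \<beta>"
  have \<kappa>: "0 \<le> \<kappa>" by (simp add: \<kappa>_def)
  \<comment> \<open>The factor 62 is chosen for the comparison of two solutions, where \<open>\<rho>\<close> reappears with the factor \<open>31 * K ^ 7 * \<kappa>\<close>.\<close>
  have K\<kappa>: "K ^ n * \<kappa> \<le> 1 / 62" if "n \<le> 7" for n
  proof -
    have "K ^ n * \<kappa> \<le> K ^ 7 * \<kappa>"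
      using that K_ge_1 \<kappa> by (intro mult_right_mono power_increasing) auto
    then show ?thesis using small by (simp add: \<kappa>_def)
  qed
  have \<kappa>1: "\<kappa> \<le> 1" using K\<kappa>[of 0] by simp
  define r where "r s t = (t - s) powr \<beta>" for s t
  have r: "0 \<le> r s t" "r s t \<le> \<kappa>" "t - s \<le> (r s t)\<^sup>2" if "c \<le> s" "s \<le> t" "t \<le> e" for s t
    using scale_facts[OF that ce] by (simp_all add: r_def \<kappa>_def)
  have rmono: "r s t \<le> r s' t'" if "s' \<le> s" "s \<le> t" "t \<le> t'" for s t s' t'
    unfolding r_def using that beta by (intro powr_mono2) auto
  have Xb: "norm (incr X s t) \<le> K * r s t" "norm (XX s t) \<le> K * (r s t)\<^sup>2"
    "norm (remainder g X y s t) \<le> \<rho> * (r s t)\<^sup>2" if "c \<le> s" "s \<le> t" "t \<le> e" for s t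
    using incr_boundD[OF X that] incr_boundD[OF XX that] incr_boundD[OF R that] by (simp_all add: r_def)
  define L where "L = K\<^sup>2 + \<rho> * \<kappa>"
  have L: "0 \<le> L" using \<rho> \<kappa> by (simp add: L_def)
  have gX: "norm (g (y s) *v incr X s t) \<le> K\<^sup>2 * r s t" if "c \<le> s" "s \<le> t" "t \<le> e" for s t
    using order_trans[OF norm_g_mult_le mult_left_mono[OF Xb(1)[OF that] K_nonneg]]
    by (simp add: power2_eq_square mult.assoc)
  have inc: "norm (incr y s t) \<le> L * r s t" if st: "c \<le> s" "s \<le> t" "t \<le> e" for s t
  proof -
    have "incr y s t = g (y s) *v incr X s t + remainder g X y s t" by (simp add: remainder_def)
    then have "norm (incr y s t) \<le> K\<^sup>2 * r s t + \<rho> * (r s t)\<^sup>2"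
      using norm_triangle_mono[OF gX[OF st] Xb(3)[OF st]] by simp
    also have "\<rho> * (r s t)\<^sup>2 \<le> \<rho> * (\<kappa> * r s t)"
      unfolding power2_eq_square using \<rho> r[OF st] by (intro mult_left_mono mult_right_mono) auto
    finally show ?thesis by (simp add: L_def algebra_simps)
  qed
  have cont: "continuous_on {c..e} y"
    by (rule continuous_on_incr_bound[of \<beta> _ _ _ L]) (use beta inc in \<open>auto simp: incr_bound_def r_def\<close>)
  have ybd: "norm (y s) \<le> B + L" if "c \<le> s" "s \<le> e" for s
  proof -
    have "norm (y s) \<le> norm (y c) + norm (incr y c s)"
      unfolding incr_def using norm_triangle_sub by blast
    also have "\<dots> \<le> B + L * 1"
      using inc[of c s] r(2)[of c s] mult_left_mono[of "r c s" 1 L] \<kappa>1 that L yc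
      by (intro add_mono) auto
    finally show ?thesis by simp
  qed
  have field: "norm (field_remainder X y s u) \<le> (K * \<rho> + K ^ 5) * (r s u)\<^sup>2"
    if su: "c \<le> s" "s \<le> u" "u \<le> e" for s u
  proof -
    define v where "v = g (y s) *v incr X s u"
    \<comment> \<open>Expanding around \<open>y s + v\<close> instead of \<open>y u\<close> lets the remainder enter through the Lipschitz bound only, so the estimate stays affine in \<open>\<rho>\<close>.\<close>
    have "y u = y s + v + remainder g X y s u" by (simp add: v_def remainder_def incr_def)
    then have "norm (g (y u) - g (y s + v)) \<le> K * norm (remainder g X y s u)"
      using g_lip[of "y u" "y s + v"] by simp
    also have "\<dots> \<le> K * (\<rho> * (r s u)\<^sup>2)" using Xb(3)[OF su] by (intro mult_left_mono) auto
    finally have 1: "norm (g (y u) - g (y s + v)) \<le> K * (\<rho> * (r s u)\<^sup>2)" .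
    have "norm (g (y s + v) - g (y s) - D (y s) v) \<le> K * (norm v)\<^sup>2"
      using taylor_increment[of "y s" v 0] by (simp add: power2_eq_square mult.assoc)
    also have "\<dots> \<le> K * (K\<^sup>2 * r s u)\<^sup>2"
      using gX[OF su] by (intro mult_left_mono power_mono) (auto simp: v_def)
    also have "\<dots> = K ^ 5 * (r s u)\<^sup>2" by (simp add: eval_nat_numeral)
    finally have 2: "norm (g (y s + v) - g (y s) - D (y s) v) \<le> K ^ 5 * (r s u)\<^sup>2" .
    have split: "field_remainder X y s u = (g (y u) - g (y s + v)) + (g (y s + v) - g (y s) - D (y s) v)"
      by (simp add: field_remainder_def v_def)
    show ?thesis
      using norm_triangle_mono[OF 1 2] unfolding split by (simp only: distrib_right mult.assoc)
  qed
  have defect: "norm (germ g X XX y x v - germ g X XX y x u - germ g X XX y u v)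
      \<le> (2 * K\<^sup>2 * \<rho> + 2 * K ^ 6) * (r x v) ^ 3"
    if xuv: "c \<le> x" "x \<le> u" "u \<le> v" "v \<le> e" for x u v
  proof -
    note rr = rmono[of x x u v] rmono[of x u v v] r[of x v] r[of x u] r[of u v]
    have "norm (field_remainder X y x u *v incr X u v) \<le> ((K * \<rho> + K ^ 5) * (r x v)\<^sup>2) * (K * r x v)"
    proof (rule order_trans[OF norm_matrix_vector_mult_le mult_mono])
      show "norm (field_remainder X y x u) \<le> (K * \<rho> + K ^ 5) * (r x v)\<^sup>2"
        by (rule order_trans[OF field]) (use rr xuv \<rho> in \<open>auto intro!: mult_left_mono power_mono\<close>)
      show "norm (incr X u v) \<le> K * r x v"
        by (rule order_trans[OF Xb(1)]) (use rr xuv in \<open>auto intro!: mult_left_mono\<close>)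
    qed (use \<rho> in auto)
    moreover have "norm (Dg_g g (y u) (XX u v) - Dg_g g (y x) (XX u v)) \<le> (K * (K * (r x v)\<^sup>2)) * (L * r x v)"
    proof (rule order_trans[OF Dg_g_lip mult_mono])
      show "K * norm (XX u v) \<le> K * (K * (r x v)\<^sup>2)"
        by (rule mult_left_mono, rule order_trans[OF Xb(2)]) (use rr xuv in \<open>auto intro!: mult_left_mono power_mono\<close>)
      show "norm (y u - y x) \<le> L * r x v"
        using inc[of x u] mult_left_mono[OF rr(1) L] xuv by (auto simp: incr_def)
    qed auto
    ultimately have "norm (germ g X XX y x v - germ g X XX y x u - germ g X XX y u v)
      \<le> ((K * \<rho> + K ^ 5) * (r x v)\<^sup>2) * (K * r x v) + (K * (K * (r x v)\<^sup>2)) * (L * r x v)"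
      unfolding germ_defect[OF chen xuv] norm_minus_cancel by (rule norm_triangle_mono)
    also have "\<dots> = (K\<^sup>2 * \<rho> + K ^ 6 + (K ^ 4 + K\<^sup>2 * (\<rho> * \<kappa>))) * (r x v) ^ 3"
      by (simp add: L_def eval_nat_numeral algebra_simps)
    also have "\<dots> \<le> (K\<^sup>2 * \<rho> + K ^ 6 + (K ^ 6 + K\<^sup>2 * (\<rho> * 1))) * (r x v) ^ 3"
      using \<rho> \<kappa>1 K_ge_1 rr xuv
      by (intro mult_right_mono add_mono mult_left_mono power_increasing order_refl) auto
    finally show ?thesis by (simp add: algebra_simps)
  qed
  show "incr_bound \<beta> 2 c e (remainder g X y) (K * (1 + B + K\<^sup>2) + K\<^sup>2 + 2 * K ^ 7 + \<rho> / 2)"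
    unfolding incr_bound_def r_def[symmetric]
  proof (intro allI impI)
    fix s t assume st: "c \<le> s" "s \<le> t" "t \<le> e"
    show "norm (remainder g X y s t) \<le> (K * (1 + B + K\<^sup>2) + K\<^sup>2 + 2 * K ^ 7 + \<rho> / 2) * (r s t)\<^sup>2"
    proof (cases "s = t")
      case True
      then show ?thesis by (simp add: remainder_def incr_def r_def)
    next
      case False
      then have "s < t" using st by simp
      have 1: "norm (remainder g X y s t - integral {s..t} (\<lambda>r. b (y r)) - Dg_g g (y s) (XX s t))
         \<le> K * (2 * K\<^sup>2 * \<rho> + 2 * K ^ 6) * (r s t) ^ 3"
        unfolding r_def
        by (rule remainder_expansion[OF eq st(1) \<open>s < t\<close> st(3)])
           (use defect[unfolded r_def] st \<rho> in auto)
      have "norm (integral {s..t} (\<lambda>r. b (y r))) \<le> K * (1 + (B + L)) * (t - s)"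
        by (rule drift_integral_le) (use st ybd cont in \<open>auto intro: continuous_on_subset\<close>)
      also have "\<dots> \<le> K * (1 + (B + L)) * (r s t)\<^sup>2"
        using r(3)[OF st] B L by (intro mult_left_mono) auto
      finally have 2: "norm (integral {s..t} (\<lambda>r. b (y r))) \<le> K * (1 + (B + L)) * (r s t)\<^sup>2" .
      have 3: "norm (Dg_g g (y s) (XX s t)) \<le> K * (K * (r s t)\<^sup>2)"
        by (rule order_trans[OF Dg_g_le]) (use Xb(2)[OF st] in \<open>auto intro: mult_left_mono\<close>)
      have "norm (remainder g X y s t) \<le> K * (2 * K\<^sup>2 * \<rho> + 2 * K ^ 6) * (r s t) ^ 3
          + K * (1 + (B + L)) * (r s t)\<^sup>2 + K * (K * (r s t)\<^sup>2)"
        using norm_triangle_mono[OF norm_triangle_mono[OF 1 2] 3] by simp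
      also have "\<dots> \<le> K * (2 * K\<^sup>2 * \<rho> + 2 * K ^ 6) * (\<kappa> * (r s t)\<^sup>2)
          + K * (1 + (B + L)) * (r s t)\<^sup>2 + K * (K * (r s t)\<^sup>2)"
      proof -
        have "(r s t) ^ 3 \<le> \<kappa> * (r s t)\<^sup>2"
          using r[OF st] mult_right_mono[of "r s t" \<kappa> "(r s t)\<^sup>2"] by (simp add: eval_nat_numeral)
        then show ?thesis using \<rho> by (intro add_mono mult_left_mono order_refl) auto
      qed
      also have "\<dots> = (K * (1 + B + K\<^sup>2) + K\<^sup>2 + 2 * K ^ 7 * \<kappa> + (2 * (K ^ 3 * \<kappa>) + K ^ 1 * \<kappa>) * \<rho>) * (r s t)\<^sup>2"
        by (simp add: L_def eval_nat_numeral algebra_simps)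
      also have "\<dots> \<le> (K * (1 + B + K\<^sup>2) + K\<^sup>2 + 2 * K ^ 7 * 1 + (2 * (1 / 62) + 1 / 62) * \<rho>) * (r s t)\<^sup>2"
        using \<kappa>1 \<rho> K\<kappa>[of 3] K\<kappa>[of 1] by (intro mult_right_mono add_mono mult_left_mono order_refl) auto
      also have "\<dots> \<le> (K * (1 + B + K\<^sup>2) + K\<^sup>2 + 2 * K ^ 7 + \<rho> / 2) * (r s t)\<^sup>2"
        using \<rho> by (intro mult_right_mono) auto
      finally show ?thesis .
    qed
  qed
qed

end

section \<open>Comparison of two solutions on a short window\<close>

context rde_field
begin

text \<open>The scheme of the a priori bound applied to the difference. Let \<open>\<rho>\<close> bound the difference of
  the remainders. The difference of the paths is then at most a multiple of \<open>\<epsilon>\<close> plus a small multiple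
  of \<open>\<rho>\<close>; inserting this into the difference of the defects returns \<open>\<rho>\<close> with factor one half, plus a
  multiple of \<open>\<epsilon>\<close>, and the factor is absorbed.\<close>

lemma difference_bound:
  assumes ce: "e - c \<le> 1" and small: "62 * K ^ 7 * (e - c) powr \<beta> \<le> 1"
    and X: "incr_bound \<beta> 1 c e (incr X) K" and XX: "incr_bound \<beta> 2 c e XX K"
    and chen: "chen_relation c e X XX"
    and X': "incr_bound \<beta> 1 c e (incr X') K" and XX': "incr_bound \<beta> 2 c e XX' K"
    and chen': "chen_relation c e X' XX'"
    and dX: "incr_bound \<beta> 1 c e (\<lambda>s t. incr X' s t - incr X s t) \<epsilon>"
    and dXX: "incr_bound \<beta> 2 c e (\<lambda>s t. XX' s t - XX s t) \<epsilon>"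
    and eq: "rde_equation g b c e X XX y" and eq': "rde_equation g b c e X' XX' z"
    and y: "incr_bound \<beta> 1 c e (incr y) K" and z: "incr_bound \<beta> 1 c e (incr z) K"
    and R: "incr_bound \<beta> 2 c e (remainder g X y) K" and R': "incr_bound \<beta> 2 c e (remainder g X' z) K"
    and eps: "0 \<le> \<epsilon>" and init: "norm (z c - y c) \<le> \<epsilon>"
  shows "t \<in> {c..e} \<Longrightarrow> norm (z t - y t) \<le> 244 * K ^ 11 * \<epsilon>"
    and "incr_bound \<beta> 1 c e (\<lambda>s t. incr z s t - incr y s t) (244 * K ^ 11 * \<epsilon>)"
    and "incr_bound \<beta> 2 c e (\<lambda>s t. remainder g X' z s t - remainder g X y s t) (244 * K ^ 11 * \<epsilon>)"
proof -
  note [simp] = K_nonneg eps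
  define \<kappa> where "\<kappa> = (e - c) powr \<beta>"
  have \<kappa>: "0 \<le> \<kappa>" by (simp add: \<kappa>_def)
  have Kpow: "K ^ m \<le> K ^ n" if "m \<le> n" for m n
    using that K_ge_1 by (intro power_increasing)
  have K\<kappa>: "K ^ n * \<kappa> \<le> 1 / 62" if "n \<le> 7" for n
  proof -
    have "K ^ n * \<kappa> \<le> K ^ 7 * \<kappa>"
      using that K_ge_1 \<kappa> by (intro mult_right_mono power_increasing) auto
    then show ?thesis using small by (simp add: \<kappa>_def)
  qed
  have \<kappa>1: "\<kappa> \<le> 1" using K\<kappa>[of 0] by simp
  define r where "r s t = (t - s) powr \<beta>" for s t
  have r: "0 \<le> r s t" "r s t \<le> \<kappa>" "t - s \<le> (r s t)\<^sup>2" if "c \<le> s" "s \<le> t" "t \<le> e" for s t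
    using scale_facts[OF that ce] by (simp_all add: r_def \<kappa>_def)
  have rmono: "r s t \<le> r s' t'" if "s' \<le> s" "s \<le> t" "t \<le> t'" for s t s' t'
    unfolding r_def using that beta by (intro powr_mono2) auto
  note bounds = X X' XX XX' dX dXX y z R R'
  have Xb: "norm (incr X s t) \<le> K * r s t" "norm (incr X' s t) \<le> K * r s t"
    "norm (XX s t) \<le> K * (r s t)\<^sup>2" "norm (XX' s t) \<le> K * (r s t)\<^sup>2"
    "norm (incr X' s t - incr X s t) \<le> \<epsilon> * r s t" "norm (XX' s t - XX s t) \<le> \<epsilon> * (r s t)\<^sup>2"
    "norm (incr y s t) \<le> K * r s t" "norm (incr z s t) \<le> K * r s t"
    "norm (remainder g X y s t) \<le> K * (r s t)\<^sup>2" "norm (remainder g X' z s t) \<le> K * (r s t)\<^sup>2"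
    if "c \<le> s" "s \<le> t" "t \<le> e" for s t
    using bounds[THEN incr_boundD, OF that] by (simp_all add: r_def)
  have cont: "continuous_on {c..e} y" "continuous_on {c..e} z"
    using beta by (auto intro: continuous_on_incr_bound[OF _ y] continuous_on_incr_bound[OF _ z])
  let ?dR = "\<lambda>s t. remainder g X' z s t - remainder g X y s t"

  \<comment> \<open>The distance is first bounded by expanding from the left end point \<open>c\<close>, where it is at most \<open>\<epsilon>\<close>; expanding from a general time would bound it in terms of itself.\<close>
  have path_bounds:
      "norm (z t - y t) \<le> 4 * K ^ 4 * \<epsilon> + 2 * K\<^sup>2 * \<rho> * \<kappa>" (is ?P1)
      "norm (incr z s t - incr y s t) \<le> (4 * K ^ 4 * \<epsilon> + 2 * K\<^sup>2 * \<rho> * \<kappa>) * r s t" (is ?P2)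
    if \<rho>: "0 \<le> \<rho>" and dR: "incr_bound \<beta> 2 c e ?dR \<rho>" and st: "c \<le> s" "s \<le> t" "t \<le> e"
    for \<rho> s t
  proof -
    have step: "norm (incr z u v - incr y u v) \<le> (K\<^sup>2 * norm (z u - y u) + K * \<epsilon> + \<rho> * \<kappa>) * r u v"
      if uv: "c \<le> u" "u \<le> v" "v \<le> e" for u v
    proof -
      have 1: "norm ((g (z u) - g (y u)) *v incr X' u v) \<le> (K * norm (z u - y u)) * (K * r u v)"
        by (rule order_trans[OF norm_matrix_vector_mult_le mult_mono]) (use g_lip Xb[OF uv] in auto)
      have 2: "norm (g (y u) *v (incr X' u v - incr X u v)) \<le> K * (\<epsilon> * r u v)"
        by (rule order_trans[OF norm_g_mult_le mult_left_mono]) (use Xb[OF uv] in auto)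
      have 3: "norm (?dR u v) \<le> \<rho> * (\<kappa> * r u v)"
      proof -
        have "norm (?dR u v) \<le> \<rho> * (r u v)\<^sup>2" using incr_boundD[OF dR uv] by (simp add: r_def)
        also have "\<rho> * (r u v)\<^sup>2 \<le> \<rho> * (\<kappa> * r u v)"
          unfolding power2_eq_square using \<rho> r[OF uv] by (intro mult_left_mono mult_right_mono) auto
        finally show ?thesis .
      qed
      have "incr z u v - incr y u v =
          (g (z u) - g (y u)) *v incr X' u v + g (y u) *v (incr X' u v - incr X u v) + ?dR u v"
        by (simp add: remainder_def matrix_vector_mult_diff_rdistrib matrix_vector_mult_diff_distrib)
      then have "norm (incr z u v - incr y u v) \<le> (K * norm (z u - y u)) * (K * r u v) + K * (\<epsilon> * r u v) + \<rho> * (\<kappa> * r u v)"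
        using norm_triangle_mono[OF norm_triangle_mono[OF 1 2] 3] by simp
      then show ?thesis by (simp add: power2_eq_square algebra_simps)
    qed
    have sup: "norm (z u - y u) \<le> 3 * K\<^sup>2 * \<epsilon> + \<rho> * \<kappa>" if u: "c \<le> u" "u \<le> e" for u
    proof -
      have "norm (incr z c u - incr y c u) \<le> (K\<^sup>2 * norm (z c - y c) + K * \<epsilon> + \<rho> * \<kappa>) * r c u"
        by (rule step) (use u in auto)
      also have "\<dots> \<le> (K\<^sup>2 * \<epsilon> + K * \<epsilon> + \<rho> * \<kappa>) * 1"
        using init r[of c u] u \<kappa>1 \<kappa> \<rho> by (intro mult_mono add_mono mult_left_mono order_refl) auto
      finally have "norm (incr z c u - incr y c u) \<le> K\<^sup>2 * \<epsilon> + K * \<epsilon> + \<rho> * \<kappa>" by simp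
      moreover have "z u - y u = (z c - y c) + (incr z c u - incr y c u)" by (simp add: incr_def)
      ultimately have "norm (z u - y u) \<le> \<epsilon> + (K\<^sup>2 * \<epsilon> + K * \<epsilon> + \<rho> * \<kappa>)"
        using norm_triangle_mono[OF init] by metis
      moreover have "K * \<epsilon> \<le> K\<^sup>2 * \<epsilon>" "\<epsilon> \<le> K\<^sup>2 * \<epsilon>"
        using Kpow[of 1 2] Kpow[of 0 2] mult_right_mono[OF _ eps, of K "K\<^sup>2"] mult_right_mono[OF _ eps, of 1 "K\<^sup>2"] by auto
      ultimately show ?thesis by linarith
    qed
    have le4: "K\<^sup>2 * \<epsilon> \<le> K ^ 4 * \<epsilon>" "K * \<epsilon> \<le> K ^ 4 * \<epsilon>" "\<rho> * \<kappa> \<le> K\<^sup>2 * \<rho> * \<kappa>"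
      using Kpow[of 2 4] Kpow[of 1 4] mult_right_mono[OF _ eps, of K "K^4"]
        mult_right_mono[OF _ eps, of "K\<^sup>2" "K^4"]
        mult_right_mono[of 1 "K\<^sup>2" "\<rho> * \<kappa>"] Kpow[of 0 2] \<rho> \<kappa> by (auto simp: mult.assoc)
    have nn: "0 \<le> K ^ 4 * \<epsilon>" "0 \<le> K\<^sup>2 * \<rho> * \<kappa>" using \<rho> \<kappa> by auto
    have "c \<le> t" using st by simp
    then show ?P1 using sup[OF _ st(3)] le4 nn by linarith
    have "norm (incr z s t - incr y s t) \<le> (K\<^sup>2 * (3 * K\<^sup>2 * \<epsilon> + \<rho> * \<kappa>) + K * \<epsilon> + \<rho> * \<kappa>) * r s t"
      by (rule order_trans[OF step[OF st]])
         (use st r[of s t] sup[of s] in \<open>auto intro!: mult_right_mono add_mono mult_left_mono\<close>)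
    also have "\<dots> \<le> (4 * K ^ 4 * \<epsilon> + 2 * K\<^sup>2 * \<rho> * \<kappa>) * r s t"
    proof (rule mult_right_mono)
      have "K\<^sup>2 * (3 * K\<^sup>2 * \<epsilon> + \<rho> * \<kappa>) = 3 * (K ^ 4 * \<epsilon>) + K\<^sup>2 * \<rho> * \<kappa>"
        by (simp add: eval_nat_numeral algebra_simps)
      then show "K\<^sup>2 * (3 * K\<^sup>2 * \<epsilon> + \<rho> * \<kappa>) + K * \<epsilon> + \<rho> * \<kappa> \<le> 4 * K ^ 4 * \<epsilon> + 2 * K\<^sup>2 * \<rho> * \<kappa>"
        using le4 by linarith
    qed (use r st in auto)
    finally show ?P2 .
  qed

  have dR0: "incr_bound \<beta> 2 c e ?dR (2 * K)"
    unfolding incr_bound_def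
  proof (intro allI impI)
    fix s t assume st: "c \<le> s" "s \<le> t" "t \<le> e"
    show "norm (?dR s t) \<le> 2 * K * ((t - s) powr \<beta>)\<^sup>2"
      using norm_triangle_ineq4[of "remainder g X' z s t" "remainder g X y s t"] Xb(9,10)[OF st]
      by (simp add: r_def)
  qed
  have dR: "incr_bound \<beta> 2 c e ?dR (2 * (60 * K ^ 9 * \<epsilon>))"
  proof (rule incr_bound_absorb[OF dR0])
    show "0 \<le> 60 * K ^ 9 * \<epsilon>" by simp
    fix \<rho> assume \<rho>: "0 \<le> \<rho>" and dR: "incr_bound \<beta> 2 c e ?dR \<rho>"
    define \<nu> where "\<nu> = 4 * K ^ 4 * \<epsilon> + 2 * K\<^sup>2 * \<rho> * \<kappa>"
    have D_sup: "norm (z s - y s) \<le> \<nu>" if "c \<le> s" "s \<le> e" for s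
      using path_bounds(1)[OF \<rho> dR that(1) order_refl that(2)] that by (simp add: \<nu>_def)
    have D_inc: "norm (incr z s t - incr y s t) \<le> \<nu> * r s t" if "c \<le> s" "s \<le> t" "t \<le> e" for s t
      using path_bounds(2)[OF \<rho> dR that] by (simp add: \<nu>_def)
    have dRb: "norm (?dR s t) \<le> \<rho> * (r s t)\<^sup>2" if "c \<le> s" "s \<le> t" "t \<le> e" for s t
      using incr_boundD[OF dR that] by (simp add: r_def)
    have \<nu>: "0 \<le> \<nu>" using \<rho> \<kappa> by (simp add: \<nu>_def)
    \<comment> \<open>From here on \<open>\<nu>\<close> bounds the initial distance, the distance of the drivers and the distance of the paths.\<close>
    have eps_\<nu>: "\<epsilon> \<le> \<nu>"
    proof -
      have "1 * \<epsilon> \<le> K ^ 4 * \<epsilon>" using Kpow[of 0 4] by (intro mult_right_mono) auto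
      moreover have "0 \<le> K\<^sup>2 * \<rho> * \<kappa>" using \<rho> \<kappa> by auto
      ultimately show ?thesis unfolding \<nu>_def using eps by linarith
    qed

    have field: "norm (field_remainder X y s u) \<le> 2 * K ^ 3 * (r s u)\<^sup>2"
      if su: "c \<le> s" "s \<le> u" "u \<le> e" for s u
    proof -
      have "norm (taylor_remainder (y s) (incr y s u)) \<le> K * (norm (incr y s u))\<^sup>2"
        using taylor_increment[of "y s" "incr y s u" 0]
        by (simp add: taylor_remainder_def power2_eq_square mult.assoc)
      also have "\<dots> \<le> K * (K * r s u)\<^sup>2"
        using Xb[OF su] by (intro mult_left_mono power_mono) auto
      finally have 1: "norm (taylor_remainder (y s) (incr y s u)) \<le> K * (K * r s u)\<^sup>2" .
      have 2: "norm (D (y s) (remainder g X y s u)) \<le> K * (K * (r s u)\<^sup>2)"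
        by (rule order_trans[OF norm_D_apply_le mult_left_mono]) (use Xb[OF su] in auto)
      have "K * (K * (r s u)\<^sup>2) \<le> K ^ 3 * (r s u)\<^sup>2"
        unfolding mult.assoc[symmetric] using Kpow[of 2 3]
        by (intro mult_right_mono) (auto simp: power2_eq_square)
      with norm_triangle_mono[OF 1 2] show ?thesis
        unfolding field_remainder_eq by (simp add: eval_nat_numeral algebra_simps)
    qed
    have field_diff: "norm (field_remainder X' z s u - field_remainder X y s u)
        \<le> (4 * K ^ 3 * \<nu> + K * \<rho>) * (r s u)\<^sup>2"
      if su: "c \<le> s" "s \<le> u" "u \<le> e" for s u
    proof -
      note rr = r[OF su]
      have Ds: "norm (z s - y s) \<le> \<nu>" using D_sup[of s] su by simp
      let ?v = "incr y s u" and ?w = "incr z s u"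
      have 1: "norm (taylor_remainder (z s) ?w - taylor_remainder (z s) ?v) \<le> K * (K * r s u + K * r s u) * (\<nu> * r s u)"
        unfolding taylor_remainder_def using Xb[OF su] D_inc[OF su] rr
        by (intro order_trans[OF taylor_increment] mult_mono mult_left_mono add_mono) auto
      have 2: "norm (taylor_remainder (z s) ?v - taylor_remainder (y s) ?v) \<le> K * \<nu> * (K * r s u)\<^sup>2"
        unfolding taylor_remainder_def using Xb[OF su] Ds rr \<nu>
        by (intro order_trans[OF taylor_base_point] mult_mono mult_left_mono power_mono) auto
      have 3: "norm (D (z s) (?dR s u)) \<le> K * (\<rho> * (r s u)\<^sup>2)"
        by (rule order_trans[OF norm_D_apply_le mult_left_mono]) (use dRb[OF su] in auto)
      have 4: "norm ((D (z s) - D (y s)) (remainder g X y s u)) \<le> (K * \<nu>) * (K * (r s u)\<^sup>2)"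
      proof (rule order_trans[OF norm_blinfun mult_mono])
        show "norm (D (z s) - D (y s)) \<le> K * \<nu>"
          by (rule order_trans[OF D_lip mult_left_mono]) (use Ds in auto)
      qed (use Xb[OF su] \<nu> in auto)
      have eq: "field_remainder X' z s u - field_remainder X y s u =
         (taylor_remainder (z s) ?w - taylor_remainder (z s) ?v)
         + (taylor_remainder (z s) ?v - taylor_remainder (y s) ?v)
         + D (z s) (?dR s u) + (D (z s) - D (y s)) (remainder g X y s u)"
        unfolding field_remainder_eq by (simp add: blinfun.diff_left blinfun.diff_right)
      have "norm (field_remainder X' z s u - field_remainder X y s u) \<le>
        K * (K * r s u + K * r s u) * (\<nu> * r s u) + K * \<nu> * (K * r s u)\<^sup>2
        + K * (\<rho> * (r s u)\<^sup>2) + (K * \<nu>) * (K * (r s u)\<^sup>2)"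
        unfolding eq by (intro norm_triangle_mono 1 2 3 4)
      also have "\<dots> = (3 * K\<^sup>2 * \<nu> + K ^ 3 * \<nu> + K * \<rho>) * (r s u)\<^sup>2"
        by (simp add: eval_nat_numeral algebra_simps)
      also have "\<dots> \<le> (3 * K ^ 3 * \<nu> + K ^ 3 * \<nu> + K * \<rho>) * (r s u)\<^sup>2"
        using Kpow[of 2 3] \<nu> by (intro mult_right_mono add_mono mult_left_mono order_refl) auto
      also have "\<dots> = (4 * K ^ 3 * \<nu> + K * \<rho>) * (r s u)\<^sup>2" by simp
      finally show ?thesis .
    qed

    have defect: "norm ((germ g X' XX' z x v - germ g X' XX' z x u - germ g X' XX' z u v)
        - (germ g X XX y x v - germ g X XX y x u - germ g X XX y u v))
        \<le> (12 * K ^ 4 * \<nu> + K\<^sup>2 * \<rho>) * (r x v) ^ 3"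
      if xuv: "c \<le> x" "x \<le> u" "u \<le> v" "v \<le> e" for x u v
    proof -
      define q where "q = r x v"
      have q: "r x u \<le> q" "r u v \<le> q" "0 \<le> q" "0 \<le> r x u" "0 \<le> r u v"
        using rmono[of x x u v] rmono[of x u v v] r[of x v] r[of x u] r[of u v] xuv by (auto simp: q_def)
      have q2: "(r x u)\<^sup>2 \<le> q\<^sup>2" "(r u v)\<^sup>2 \<le> q\<^sup>2" using q by (auto intro: power_mono)
      have le_q: "norm (incr X' u v) \<le> K * q" "norm (XX' u v) \<le> K * q\<^sup>2"
        "norm (incr X' u v - incr X u v) \<le> \<nu> * q" "norm (XX' u v - XX u v) \<le> \<nu> * q\<^sup>2"
        "norm (incr y x u) \<le> K * q" "norm (incr z x u) \<le> K * q" "norm (incr z x u - incr y x u) \<le> \<nu> * q"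
      proof -
        have up: "N \<le> C' * p'" if "N \<le> C * p" "C \<le> C'" "p \<le> p'" "0 \<le> p" "0 \<le> C'" for N C C' p p' :: real
          using order_trans[OF that(1) mult_mono[OF that(2,3,5,4)]] .
        have uv: "c \<le> u" "u \<le> v" "v \<le> e" and xu: "c \<le> x" "x \<le> u" "u \<le> e" using xuv by auto
        show "norm (incr X' u v) \<le> K * q" "norm (XX' u v) \<le> K * q\<^sup>2"
          using up[OF Xb(2)[OF uv] order_refl q(2)] up[OF Xb(4)[OF uv] order_refl q2(2)] q by auto
        show "norm (incr X' u v - incr X u v) \<le> \<nu> * q" "norm (XX' u v - XX u v) \<le> \<nu> * q\<^sup>2"
          using up[OF Xb(5)[OF uv] eps_\<nu> q(2)] up[OF Xb(6)[OF uv] eps_\<nu> q2(2)] q \<nu> by auto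
        show "norm (incr y x u) \<le> K * q" "norm (incr z x u) \<le> K * q"
          using up[OF Xb(7)[OF xu] order_refl q(1)] up[OF Xb(8)[OF xu] order_refl q(1)] q by auto
        show "norm (incr z x u - incr y x u) \<le> \<nu> * q"
          using up[OF D_inc[OF xu] order_refl q(1)] q \<nu> by auto
      qed
      have 1: "norm ((field_remainder X' z x u - field_remainder X y x u) *v incr X' u v)
          \<le> ((4 * K ^ 3 * \<nu> + K * \<rho>) * q\<^sup>2) * (K * q)"
      proof (rule order_trans[OF norm_matrix_vector_mult_le mult_mono])
        show "norm (field_remainder X' z x u - field_remainder X y x u) \<le> (4 * K ^ 3 * \<nu> + K * \<rho>) * q\<^sup>2"
          by (rule order_trans[OF field_diff]) (use xuv q2 \<nu> \<rho> in \<open>auto intro!: mult_left_mono\<close>)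
      qed (use le_q \<nu> \<rho> in auto)
      have 2: "norm (field_remainder X y x u *v (incr X' u v - incr X u v)) \<le> (2 * K ^ 3 * q\<^sup>2) * (\<nu> * q)"
      proof (rule order_trans[OF norm_matrix_vector_mult_le mult_mono])
        show "norm (field_remainder X y x u) \<le> 2 * K ^ 3 * q\<^sup>2"
          by (rule order_trans[OF field]) (use xuv q2 in \<open>auto intro!: mult_left_mono\<close>)
      qed (use le_q in auto)
      have 3: "norm (Dg_g g (z u) (XX' u v) - Dg_g g (z x) (XX' u v) - (Dg_g g (y u) (XX' u v) - Dg_g g (y x) (XX' u v)))
          \<le> (K * (K * q\<^sup>2)) * (\<nu> * q + (\<nu> + \<nu>) * (K * q + K * q))"
      proof (rule order_trans[OF Dg_g_four mult_mono])
        show "K * norm (XX' u v) \<le> K * (K * q\<^sup>2)" using le_q by (intro mult_left_mono) auto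
        show "norm (z u - z x - (y u - y x)) + (norm (z x - y x) + norm (z u - y u)) * (norm (z u - z x) + norm (y u - y x))
            \<le> \<nu> * q + (\<nu> + \<nu>) * (K * q + K * q)"
          using le_q D_sup[of x] D_sup[of u] xuv \<nu> unfolding incr_def
          by (intro add_mono mult_mono) auto
      qed auto
      have 4: "norm (Dg_g g (y u) (XX' u v - XX u v) - Dg_g g (y x) (XX' u v - XX u v)) \<le> (K * (\<nu> * q\<^sup>2)) * (K * q)"
        using le_q unfolding incr_def
        by (intro order_trans[OF Dg_g_lip] mult_mono mult_left_mono) (use \<nu> in auto)
      \<comment> \<open>Each of the four summands contains exactly one difference between the two systems, and the other factors have the orders that make the sum of third order.\<close>
      have eq: "(germ g X' XX' z x v - germ g X' XX' z x u - germ g X' XX' z u v)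
        - (germ g X XX y x v - germ g X XX y x u - germ g X XX y u v) =
        - ((field_remainder X' z x u - field_remainder X y x u) *v incr X' u v
         + field_remainder X y x u *v (incr X' u v - incr X u v)
         + (Dg_g g (z u) (XX' u v) - Dg_g g (z x) (XX' u v) - (Dg_g g (y u) (XX' u v) - Dg_g g (y x) (XX' u v)))
         + (Dg_g g (y u) (XX' u v - XX u v) - Dg_g g (y x) (XX' u v - XX u v)))"
        unfolding germ_defect[OF chen xuv] germ_defect[OF chen' xuv]
        by (simp add: Dg_g_diff matrix_vector_mult_diff_rdistrib matrix_vector_mult_diff_distrib)
      have "norm ((germ g X' XX' z x v - germ g X' XX' z x u - germ g X' XX' z u v)
        - (germ g X XX y x v - germ g X XX y x u - germ g X XX y u v))
        \<le> ((4 * K ^ 3 * \<nu> + K * \<rho>) * q\<^sup>2) * (K * q) + (2 * K ^ 3 * q\<^sup>2) * (\<nu> * q)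
          + (K * (K * q\<^sup>2)) * (\<nu> * q + (\<nu> + \<nu>) * (K * q + K * q)) + (K * (\<nu> * q\<^sup>2)) * (K * q)"
        unfolding eq norm_minus_cancel by (intro norm_triangle_mono 1 2 3 4)
      also have "\<dots> = ((4 * K ^ 4 + 6 * K ^ 3 + 2 * K\<^sup>2) * \<nu> + K\<^sup>2 * \<rho>) * q ^ 3"
        by (simp add: eval_nat_numeral algebra_simps)
      also have "\<dots> \<le> ((4 * K ^ 4 + 6 * K ^ 4 + 2 * K ^ 4) * \<nu> + K\<^sup>2 * \<rho>) * q ^ 3"
        using Kpow[of 3 4] Kpow[of 2 4] \<nu> q
        by (intro mult_right_mono add_mono mult_left_mono order_refl) auto
      also have "\<dots> = (12 * K ^ 4 * \<nu> + K\<^sup>2 * \<rho>) * (r x v) ^ 3" by (simp add: q_def)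
      finally show ?thesis .
    qed

    show "incr_bound \<beta> 2 c e ?dR (60 * K ^ 9 * \<epsilon> + \<rho> / 2)"
      unfolding incr_bound_def r_def[symmetric]
    proof (intro allI impI)
      fix s t assume st: "c \<le> s" "s \<le> t" "t \<le> e"
      show "norm (?dR s t) \<le> (60 * K ^ 9 * \<epsilon> + \<rho> / 2) * (r s t)\<^sup>2"
      proof (cases "s = t")
        case True
        then show ?thesis by (simp add: remainder_def incr_def r_def)
      next
        case False
        then have "s < t" using st by simp
        let ?I = "\<lambda>y. integral {s..t} (\<lambda>r. b (y r))"
        have 1: "norm ((remainder g X' z s t - ?I z - Dg_g g (z s) (XX' s t))
            - (remainder g X y s t - ?I y - Dg_g g (y s) (XX s t)))
           \<le> K * (12 * K ^ 4 * \<nu> + K\<^sup>2 * \<rho>) * (r s t) ^ 3"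
          unfolding r_def
          by (rule remainder_difference_expansion[OF eq eq' st(1) \<open>s < t\<close> st(3)])
             (use defect[unfolded r_def] st \<rho> \<nu> in auto)
        have "norm (?I z - ?I y) \<le> K * \<nu> * (t - s)"
          by (rule drift_integral_difference_le)
             (use st D_sup cont in \<open>auto intro: continuous_on_subset\<close>)
        also have "\<dots> \<le> K * \<nu> * (r s t)\<^sup>2" using r(3)[OF st] \<nu> by (intro mult_left_mono) auto
        finally have 2: "norm (?I z - ?I y) \<le> K * \<nu> * (r s t)\<^sup>2" .
        have 3: "norm (Dg_g g (z s) (XX' s t) - Dg_g g (y s) (XX' s t)) \<le> (K * (K * (r s t)\<^sup>2)) * \<nu>"
          by (intro order_trans[OF Dg_g_lip] mult_mono mult_left_mono)
             (use Xb[OF st] D_sup[of s] st \<nu> in auto)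
        have 4: "norm (Dg_g g (y s) (XX' s t - XX s t)) \<le> K * (\<nu> * (r s t)\<^sup>2)"
        proof (intro order_trans[OF Dg_g_le] mult_left_mono)
          show "norm (XX' s t - XX s t) \<le> \<nu> * (r s t)\<^sup>2"
            using Xb(6)[OF st] mult_right_mono[OF eps_\<nu>, of "(r s t)\<^sup>2"] by simp
        qed simp
        have deq: "?dR s t = ((remainder g X' z s t - ?I z - Dg_g g (z s) (XX' s t))
            - (remainder g X y s t - ?I y - Dg_g g (y s) (XX s t)))
            + (?I z - ?I y) + (Dg_g g (z s) (XX' s t) - Dg_g g (y s) (XX' s t))
            + Dg_g g (y s) (XX' s t - XX s t)"
          by (simp add: Dg_g_diff)
        have "norm (?dR s t) \<le> K * (12 * K ^ 4 * \<nu> + K\<^sup>2 * \<rho>) * (r s t) ^ 3 + K * \<nu> * (r s t)\<^sup>2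
            + (K * (K * (r s t)\<^sup>2)) * \<nu> + K * (\<nu> * (r s t)\<^sup>2)"
          unfolding deq by (intro norm_triangle_mono 1 2 3 4)
        also have "\<dots> \<le> K * (12 * K ^ 4 * \<nu> + K\<^sup>2 * \<rho>) * (\<kappa> * (r s t)\<^sup>2) + K * \<nu> * (r s t)\<^sup>2
            + (K * (K * (r s t)\<^sup>2)) * \<nu> + K * (\<nu> * (r s t)\<^sup>2)"
        proof -
          have "(r s t) ^ 3 \<le> \<kappa> * (r s t)\<^sup>2"
            using r[OF st] mult_right_mono[of "r s t" \<kappa> "(r s t)\<^sup>2"] by (simp add: eval_nat_numeral)
          then show ?thesis using \<rho> \<nu> by (intro add_mono mult_left_mono order_refl) auto
        qed
        also have "\<dots> = ((12 * K ^ 5 * \<kappa> + 2 * K ^ 1 + K\<^sup>2) * \<nu> + K ^ 3 * \<kappa> * \<rho>) * (r s t)\<^sup>2"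
          by (simp add: eval_nat_numeral algebra_simps)
        also have "\<dots> \<le> ((12 * K ^ 5 * 1 + 2 * K ^ 5 + K ^ 5) * \<nu> + K ^ 7 * \<kappa> * \<rho>) * (r s t)\<^sup>2"
          using \<kappa>1 \<rho> \<nu> \<kappa> Kpow[of 1 5] Kpow[of 2 5] Kpow[of 3 7]
          by (intro mult_right_mono add_mono mult_left_mono order_refl) auto
        also have "\<dots> = (60 * K ^ 9 * \<epsilon> + 31 * (K ^ 7 * \<kappa>) * \<rho>) * (r s t)\<^sup>2"
          by (simp add: \<nu>_def eval_nat_numeral algebra_simps)
        also have "\<dots> \<le> (60 * K ^ 9 * \<epsilon> + 31 * (1 / 62) * \<rho>) * (r s t)\<^sup>2"
          using \<rho> K\<kappa>[of 7] by (intro mult_right_mono add_mono mult_left_mono order_refl) auto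
        finally show ?thesis by simp
      qed
    qed
  qed

  have K9: "60 * K ^ 9 * \<epsilon> \<le> 60 * K ^ 11 * \<epsilon>" "K ^ 4 * \<epsilon> \<le> K ^ 11 * \<epsilon>"
    using Kpow[of 9 11] Kpow[of 4 11] by (auto intro: mult_right_mono)
  have K11: "0 \<le> K ^ 11 * \<epsilon>" by simp
  have \<nu>le: "4 * K ^ 4 * \<epsilon> + 2 * K\<^sup>2 * (2 * (60 * K ^ 9 * \<epsilon>)) * \<kappa> \<le> 244 * K ^ 11 * \<epsilon>"
  proof -
    have "2 * K\<^sup>2 * (2 * (60 * K ^ 9 * \<epsilon>)) * \<kappa> = 240 * (K ^ 11 * \<epsilon>) * \<kappa>"
      by (simp add: eval_nat_numeral algebra_simps)
    also have "\<dots> \<le> 240 * (K ^ 11 * \<epsilon>) * 1" using \<kappa>1 by (intro mult_left_mono) auto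
    finally show ?thesis using K9 by simp
  qed
  have nn: "0 \<le> 2 * (60 * K ^ 9 * \<epsilon>)" by simp
  show "norm (z t - y t) \<le> 244 * K ^ 11 * \<epsilon>" if "t \<in> {c..e}" for t
    using order_trans[OF path_bounds(1)[OF nn dR _ order_refl] \<nu>le, of t] that by auto
  show "incr_bound \<beta> 1 c e (\<lambda>s t. incr z s t - incr y s t) (244 * K ^ 11 * \<epsilon>)"
    unfolding incr_bound_def
  proof (intro allI impI)
    fix s t assume st: "c \<le> s" "s \<le> t" "t \<le> e"
    show "norm (incr z s t - incr y s t) \<le> 244 * K ^ 11 * \<epsilon> * ((t - s) powr \<beta>) ^ 1"
      using path_bounds(2)[OF nn dR st] mult_right_mono[OF \<nu>le r(1)[OF st]] by (simp add: r_def)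
  qed
  show "incr_bound \<beta> 2 c e ?dR (244 * K ^ 11 * \<epsilon>)"
    by (rule incr_bound_mono[OF dR]) (use K9 K11 in linarith)
qed

end

section \<open>Stability on the whole interval\<close>

context rde_field
begin

text \<open>On windows of length at most one, a second order bound is also a first order bound.\<close>

lemma incr_bound_of_remainder:
  assumes "e - c \<le> 1" and X: "incr_bound \<beta> 1 c e (incr X) K"
    and R: "incr_bound \<beta> 2 c e (remainder g X y) \<rho>" and "0 \<le> \<rho>"
  shows "incr_bound \<beta> 1 c e (incr y) (K\<^sup>2 + \<rho>)"
  unfolding incr_bound_def
proof (intro allI impI)
  fix s t assume st: "c \<le> s" "s \<le> t" "t \<le> e"
  let ?r = "(t - s) powr \<beta>"
  have "?r \<le> (e - c) powr \<beta>" using scale_facts[OF st assms(1)] by simp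
  also have "\<dots> \<le> 1 powr \<beta>" using assms(1) st beta by (intro powr_mono2) auto
  finally have r: "?r \<le> 1" by simp
  have 1: "norm (g (y s) *v incr X s t) \<le> K * (K * ?r)"
    by (rule order_trans[OF norm_g_mult_le mult_left_mono])
       (use incr_boundD[OF X st] K_nonneg in auto)
  have "\<rho> * ?r\<^sup>2 \<le> \<rho> * ?r"
    using r \<open>0 \<le> \<rho>\<close> by (intro mult_left_mono) (auto simp: power2_eq_square mult_left_le)
  with incr_boundD[OF R st] have 2: "norm (remainder g X y s t) \<le> \<rho> * ?r" by linarith
  have "incr y s t = g (y s) *v incr X s t + remainder g X y s t" by (simp add: remainder_def)
  then show "norm (incr y s t) \<le> (K\<^sup>2 + \<rho>) * ?r ^ 1"
    using norm_triangle_mono[OF 1 2] by (simp add: power2_eq_square algebra_simps)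
qed

text \<open>A constant that dominates \<open>K\<close>, the a priori bound for remainders of solutions that start in the
  ball of radius \<open>B\<close>, and the resulting bound for their increments.\<close>

definition window_constant :: "real \<Rightarrow> real" where
  "window_constant B = K\<^sup>2 + 2 * (K * (1 + B + K\<^sup>2) + K\<^sup>2 + 2 * K ^ 7)"

text \<open>The a priori bound supplies the bounds on both solutions that their comparison requires; the
  comparison then takes place with the larger constant.\<close>

lemma window_difference:
  assumes "0 \<le> B" and ce: "e - c \<le> 1"
    and small: "62 * window_constant B ^ 7 * (e - c) powr \<beta> \<le> 1"
    and X: "incr_bound \<beta> 1 c e (incr X) K" and XX: "incr_bound \<beta> 2 c e XX K"
    and chen: "chen_relation c e X XX"
    and X': "incr_bound \<beta> 1 c e (incr X') K" and XX': "incr_bound \<beta> 2 c e XX' K"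
    and chen': "chen_relation c e X' XX'"
    and dX: "incr_bound \<beta> 1 c e (\<lambda>s t. incr X' s t - incr X s t) \<epsilon>"
    and dXX: "incr_bound \<beta> 2 c e (\<lambda>s t. XX' s t - XX s t) \<epsilon>"
    and eq: "rde_equation g b c e X XX y" and eq': "rde_equation g b c e X' XX' z"
    and R: "incr_bound \<beta> 2 c e (remainder g X y) \<rho>" and R': "incr_bound \<beta> 2 c e (remainder g X' z) \<rho>'"
    and yc: "norm (y c) \<le> B" and zc: "norm (z c) \<le> B"
    and eps: "0 \<le> \<epsilon>" and init: "norm (z c - y c) \<le> \<epsilon>"
  shows "t \<in> {c..e} \<Longrightarrow> norm (z t - y t) \<le> 244 * window_constant B ^ 11 * \<epsilon>" (is "_ \<Longrightarrow> ?T1")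
    and "incr_bound \<beta> 1 c e (\<lambda>s t. incr z s t - incr y s t) (244 * window_constant B ^ 11 * \<epsilon>)" (is ?T2)
    and "incr_bound \<beta> 2 c e (\<lambda>s t. remainder g X' z s t - remainder g X y s t) (244 * window_constant B ^ 11 * \<epsilon>)" (is ?T3)
proof -
  let ?L = "window_constant B"
  define A where "A = 2 * (K * (1 + B + K\<^sup>2) + K\<^sup>2 + 2 * K ^ 7)"
  have A: "0 \<le> A" using K_nonneg \<open>0 \<le> B\<close> by (simp add: A_def)
  have L: "?L = K\<^sup>2 + A" by (simp add: window_constant_def A_def)
  have "K * 1 \<le> K * K" using K_ge_1 by (intro mult_left_mono) auto
  then have KL: "K \<le> ?L" using A by (simp add: L power2_eq_square)
  have "A \<le> ?L" by (simp add: L)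
  interpret L: rde_field \<beta> ?L g D b using rde_field_mono[OF rde_field_axioms KL] .
  have small': "62 * K ^ 7 * (e - c) powr \<beta> \<le> 1"
    by (rule order_trans[OF _ small]) (use KL K_nonneg in \<open>intro mult_right_mono mult_left_mono power_mono; auto\<close>)
  have Ry: "incr_bound \<beta> 2 c e (remainder g X y) A"
    unfolding A_def by (rule a_priori_bound[OF ce small' X XX chen eq R yc])
  have Rz: "incr_bound \<beta> 2 c e (remainder g X' z) A"
    unfolding A_def by (rule a_priori_bound[OF ce small' X' XX' chen' eq' R' zc])
  have y: "incr_bound \<beta> 1 c e (incr y) ?L" unfolding L by (rule incr_bound_of_remainder[OF ce X Ry A])
  have z: "incr_bound \<beta> 1 c e (incr z) ?L" unfolding L by (rule incr_bound_of_remainder[OF ce X' Rz A])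
  note concl = L.difference_bound[OF ce small incr_bound_mono[OF X KL] incr_bound_mono[OF XX KL] chen
      incr_bound_mono[OF X' KL] incr_bound_mono[OF XX' KL] chen' dX dXX eq eq' y z
      incr_bound_mono[OF Ry \<open>A \<le> ?L\<close>] incr_bound_mono[OF Rz \<open>A \<le> ?L\<close>] eps init]
  show "t \<in> {c..e} \<Longrightarrow> ?T1" by (rule concl(1))
  show ?T2 using concl(2) .
  show ?T3 using concl(3) .
qed

end

lemma chen_relation_subinterval:
  "chen_relation a e X XX \<Longrightarrow> a \<le> a' \<Longrightarrow> e' \<le> e \<Longrightarrow> chen_relation a' e' X XX"
  unfolding chen_relation_def by (meson order_trans)

lemma rde_equation_subinterval:
  "rde_equation g b a e X XX y \<Longrightarrow> a \<le> a' \<Longrightarrow> e' \<le> e \<Longrightarrow> rde_equation g b a' e' X XX y"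
  unfolding rde_equation_def by (meson order_trans)

text \<open>The admissible window length depends only on the coefficients, the driving path \<open>X\<close> and a ball
  containing \<open>y\<close> with a margin of one. Hence finitely many windows cover the interval, each
  multiplies the distance of the solutions by a fixed factor, and for small \<open>\<epsilon>\<close> the perturbed solution
  never leaves the ball. Remainders are not additive and cannot be glued from window to window.
  Instead, once the distance is controlled everywhere, a window is started at each time \<open>s\<close>; for times
  further apart than a window, the scale is bounded below and crude bounds are enough.\<close>

theorem rde_stability:
  fixes X :: "real \<Rightarrow> real^'d" and y :: "real \<Rightarrow> real^'m"
  assumes field: "rde_field \<beta> K0 g D b" and "a \<le> e"
    and X: "incr_bound \<beta> 1 a e (incr X) M" and XX: "incr_bound \<beta> 2 a e XX M"
    and chen: "chen_relation a e X XX" and eq: "rde_equation g b a e X XX y"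
    and y: "incr_bound \<beta> 1 a e (incr y) \<rho>" and R: "incr_bound \<beta> 2 a e (remainder g X y) \<rho>"
  obtains C where "0 \<le> C" and
    "\<And>\<epsilon> X' XX' z \<rho>'. 0 \<le> \<epsilon> \<Longrightarrow> C * \<epsilon> \<le> 1 \<Longrightarrow>
       incr_bound \<beta> 1 a e (\<lambda>s t. incr X' s t - incr X s t) \<epsilon> \<Longrightarrow>
       incr_bound \<beta> 2 a e (\<lambda>s t. XX' s t - XX s t) \<epsilon> \<Longrightarrow>
       chen_relation a e X' XX' \<Longrightarrow> rde_equation g b a e X' XX' z \<Longrightarrow>
       incr_bound \<beta> 2 a e (remainder g X' z) \<rho>' \<Longrightarrow> norm (z a - y a) \<le> \<epsilon> \<Longrightarrow>
       (\<forall>t\<in>{a..e}. norm (z t - y t) \<le> C * \<epsilon>) \<and>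
       incr_bound \<beta> 1 a e (\<lambda>s t. incr z s t - incr y s t) (C * \<epsilon>) \<and>
       incr_bound \<beta> 2 a e (\<lambda>s t. remainder g X' z s t - remainder g X y s t) (C * \<epsilon>)"
proof -
  define K where "K = max K0 (M + 1)"
  have K: "K0 \<le> K" "M + 1 \<le> K" by (auto simp: K_def)
  interpret rde_field \<beta> K g D b by (rule rde_field_mono[OF field K(1)])
  note [simp] = K_nonneg
  have "continuous_on {a..e} y" using continuous_on_incr_bound[OF _ y] beta by simp
  then have "bounded (y ` {a..e})"
    by (intro compact_imp_bounded compact_continuous_image) auto
  then obtain B0 where B0: "\<forall>x\<in>y ` {a..e}. norm x \<le> B0" unfolding bounded_iff ..
  define B where "B = B0 + 1"
  have B: "norm (y t) + 1 \<le> B" if "t \<in> {a..e}" for t using B0 that by (simp add: B_def)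
  have B0: "0 \<le> B" using B[of a] \<open>a \<le> e\<close> norm_ge_zero[of "y a"] by (simp del: norm_ge_zero)
  define L where "L = window_constant B"
  have L: "1 \<le> L"
  proof -
    have "1 \<le> K\<^sup>2" using K_ge_1 by simp
    then show ?thesis
      unfolding L_def window_constant_def using B0 by (intro add_increasing2) auto
  qed
  \<comment> \<open>The window length solves \<open>62 * L ^ 7 * h powr \<beta> = 1\<close>, unless that exceeds one.\<close>
  define h where "h = min 1 ((1 / (62 * L ^ 7)) powr (1 / \<beta>))"
  have h: "0 < h" "h \<le> 1" using L by (auto simp: h_def)
  have h_small: "62 * L ^ 7 * d powr \<beta> \<le> 1" if "0 \<le> d" "d \<le> h" for d
  proof -
    have "d powr \<beta> \<le> ((1 / (62 * L ^ 7)) powr (1 / \<beta>)) powr \<beta>"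
      using that beta by (intro powr_mono2) (auto simp: h_def)
    also have "\<dots> = 1 / (62 * L ^ 7)" using beta L by (simp add: powr_powr)
    finally show ?thesis using L by (simp add: field_simps)
  qed
  define G where "G = 244 * L ^ 11"
  have G: "1 \<le> G" using one_le_power[OF L, of 11] by (simp add: G_def)
  define N where "N = nat \<lceil>(e - a) / h\<rceil>"
  have N: "e \<le> a + real N * h"
  proof -
    have "(e - a) / h \<le> real N" unfolding N_def by linarith
    then show ?thesis using h by (simp add: field_simps)
  qed
  define w where "w = h powr \<beta>"
  have w: "0 < w" "w \<le> 1" using h beta powr_mono2[of \<beta> h 1] by (auto simp: w_def)
  \<comment> \<open>For times at distance at least \<open>h\<close>: \<open>1 \<le> r / w\<close>, so bounds of any order become second order bounds at the price of powers of \<open>1 / w\<close>.\<close>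
  define C1 where "C1 = (2 + 2 * K\<^sup>2) / w\<^sup>2"
  have C1: "0 \<le> C1" by (simp add: C1_def)
  define C where "C = (G + C1) * G ^ N"
  have GN: "1 \<le> G ^ N" using G by simp
  have GNC: "G ^ N \<le> C"
    using mult_right_mono[of 1 "G + C1" "G ^ N"] G GN C1 by (simp add: C_def)
  show thesis
  proof (rule that)
    show "0 \<le> C" using GNC GN by linarith
    fix \<epsilon> X' XX' z \<rho>'
    assume eps: "0 \<le> \<epsilon>" and C\<epsilon>: "C * \<epsilon> \<le> 1"
      and dX: "incr_bound \<beta> 1 a e (\<lambda>s t. incr X' s t - incr X s t) \<epsilon>"
      and dXX: "incr_bound \<beta> 2 a e (\<lambda>s t. XX' s t - XX s t) \<epsilon>"
      and chen': "chen_relation a e X' XX'" and eq': "rde_equation g b a e X' XX' z"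
      and R': "incr_bound \<beta> 2 a e (remainder g X' z) \<rho>'" and init: "norm (z a - y a) \<le> \<epsilon>"
    \<comment> \<open>The distance after all \<open>N\<close> windows.\<close>
    define \<epsilon>1 where "\<epsilon>1 = G ^ N * \<epsilon>"
    have eps1: "\<epsilon> \<le> \<epsilon>1" "\<epsilon>1 \<le> 1"
      using mult_right_mono[OF GN eps] mult_right_mono[OF GNC eps] C\<epsilon> by (simp_all add: \<epsilon>1_def)
    then have eps_1: "\<epsilon> \<le> 1" "0 \<le> \<epsilon>1" using eps by auto
    have X'K: "incr_bound \<beta> 1 a e (incr X') K" and XX'K: "incr_bound \<beta> 2 a e XX' K"
    proof -
      have le: "u' \<le> K * x" if "u \<le> M * x" "d \<le> \<epsilon> * x" "u' \<le> u + d" "0 \<le> x" for u d u' x :: real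
        using that mult_right_mono[of "M + \<epsilon>" K x] K eps_1 by (simp add: distrib_right)
      show "incr_bound \<beta> 1 a e (incr X') K"
        unfolding incr_bound_def
      proof (intro allI impI)
        fix s t assume st: "a \<le> s" "s \<le> t" "t \<le> e"
        show "norm (incr X' s t) \<le> K * ((t - s) powr \<beta>) ^ 1"
          by (rule le[OF incr_boundD[OF X st] incr_boundD[OF dX st] norm_triangle_sub]) simp
      qed
      show "incr_bound \<beta> 2 a e XX' K"
        unfolding incr_bound_def
      proof (intro allI impI)
        fix s t assume st: "a \<le> s" "s \<le> t" "t \<le> e"
        show "norm (XX' s t) \<le> K * ((t - s) powr \<beta>) ^ 2"
          by (rule le[OF incr_boundD[OF XX st] incr_boundD[OF dXX st] norm_triangle_sub]) simp
      qed
    qed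
    have "M \<le> K" using K by simp
    note XK = incr_bound_mono[OF X this] and XXK = incr_bound_mono[OF XX this]
    have window:
        "norm (z t - y t) \<le> G * \<epsilon>'" (is ?W1)
        "norm (incr z s t - incr y s t) \<le> G * \<epsilon>' * (t - s) powr \<beta>" (is ?W2)
        "norm (remainder g X' z s t - remainder g X y s t) \<le> G * \<epsilon>' * ((t - s) powr \<beta>)\<^sup>2" (is ?W3)
      if st: "a \<le> s" "s \<le> t" "t \<le> e" and "t - s \<le> h"
        and \<epsilon>': "\<epsilon> \<le> \<epsilon>'" "\<epsilon>' \<le> 1" and d: "norm (z s - y s) \<le> \<epsilon>'" for s t \<epsilon>'
    proof -
      note sub = incr_bound_subinterval[OF _ st(1,3)]
      \<comment> \<open>The margin of one in the choice of \<open>B\<close> keeps \<open>z\<close> in the ball.\<close>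
      have ys: "norm (y s) \<le> B" "norm (z s) \<le> B"
        using B[of s] norm_triangle_sub[of "z s" "y s"] d \<epsilon>' st by auto
      have ts: "t - s \<le> 1" "0 \<le> \<epsilon>'" using \<open>t - s \<le> h\<close> h eps \<epsilon>' by auto
      have small: "62 * window_constant B ^ 7 * (t - s) powr \<beta> \<le> 1"
        using h_small[of "t - s"] st \<open>t - s \<le> h\<close> by (simp add: L_def)
      note W = window_difference[OF B0 ts(1) small sub[OF XK] sub[OF XXK]
          chen_relation_subinterval[OF chen st(1,3)] sub[OF X'K] sub[OF XX'K]
          chen_relation_subinterval[OF chen' st(1,3)]
          incr_bound_mono[OF sub[OF dX] \<epsilon>'(1)] incr_bound_mono[OF sub[OF dXX] \<epsilon>'(1)]
          rde_equation_subinterval[OF eq st(1,3)] rde_equation_subinterval[OF eq' st(1,3)]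
          sub[OF R] sub[OF R'] ys ts(2) d]
      show ?W1 using W(1)[of t] st by (simp add: G_def L_def)
      show ?W2 using incr_boundD[OF W(2), of s t] st by (simp add: G_def L_def)
      show ?W3 using incr_boundD[OF W(3), of s t] st by (simp add: G_def L_def)
    qed
    have sup_n: "norm (z t - y t) \<le> G ^ n * \<epsilon>" if "n \<le> N" "a \<le> t" "t \<le> e" "t \<le> a + real n * h" for n t
      using that
    proof (induction n arbitrary: t)
      case 0
      then show ?case using init by simp
    next
      case (Suc n)
      have Gn: "1 \<le> G ^ n" "G ^ n \<le> G ^ N" "G ^ n \<le> G ^ Suc n"
        using G Suc.prems by (auto intro: power_increasing)
      show ?case
      proof (cases "t \<le> a + real n * h")
        case True
        then show ?thesis
          using Suc.IH[of t] Suc.prems mult_right_mono[OF Gn(3) eps] by auto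
      next
        case False
        define c where "c = a + real n * h"
        have c: "a \<le> c" "c \<le> t" "t - c \<le> h"
          using h False Suc.prems by (auto simp: c_def algebra_simps)
        have "norm (z t - y t) \<le> G * (G ^ n * \<epsilon>)"
        proof (rule window(1)[OF c(1,2) Suc.prems(3) c(3)])
          show "\<epsilon> \<le> G ^ n * \<epsilon>" using mult_right_mono[OF Gn(1) eps] by simp
          show "G ^ n * \<epsilon> \<le> 1"
            using mult_right_mono[OF Gn(2) eps] eps1 by (simp add: \<epsilon>1_def)
          show "norm (z c - y c) \<le> G ^ n * \<epsilon>"
            by (rule Suc.IH) (use Suc.prems c in \<open>auto simp: c_def\<close>)
        qed
        then show ?thesis by (simp add: mult.assoc)
      qed
    qed
    have sup: "norm (z t - y t) \<le> \<epsilon>1" if "a \<le> t" "t \<le> e" for t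
      unfolding \<epsilon>1_def by (rule sup_n) (use that N in auto)
    have C_eq: "C * \<epsilon> = (G + C1) * \<epsilon>1" by (simp add: C_def \<epsilon>1_def)
    have le_C: "G * \<epsilon>1 * x \<le> C * \<epsilon> * x" "C1 * \<epsilon>1 * x \<le> C * \<epsilon> * x" if "0 \<le> x" for x
      unfolding C_eq using that C1 G eps_1 by (auto intro!: mult_right_mono)
    have far: "norm (incr z s t - incr y s t) \<le> C1 * \<epsilon>1 * (t - s) powr \<beta>" (is ?F1)
        "norm (remainder g X' z s t - remainder g X y s t) \<le> C1 * \<epsilon>1 * ((t - s) powr \<beta>)\<^sup>2" (is ?F2)
      if st: "a \<le> s" "s \<le> t" "t \<le> e" and "h \<le> t - s" for s t
    proof -
      define r where "r = (t - s) powr \<beta>"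
      have wr: "w \<le> r" unfolding w_def r_def using that h beta by (intro powr_mono2) auto
      then have r: "0 < r" using w by simp
      have rw: "1 \<le> r / w" "r \<le> r / w\<^sup>2 * r" "1 \<le> r\<^sup>2 / w\<^sup>2" "1 \<le> r / w\<^sup>2"
      proof -
        show 1: "1 \<le> r / w" using wr w by simp
        have "w\<^sup>2 \<le> w" using w by (simp add: power2_eq_square mult_left_le)
        then show 2: "1 \<le> r / w\<^sup>2" using wr w by (simp add: divide_simps)
        show "r \<le> r / w\<^sup>2 * r" using mult_right_mono[OF 2, of r] r by simp
        show "1 \<le> r\<^sup>2 / w\<^sup>2" using one_le_power[OF 1, of 2] by (simp add: power_divide)
      qed
      have incr_le: "norm (incr z s t - incr y s t) \<le> 2 * \<epsilon>1"
      proof -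
        have "incr z s t - incr y s t = (z t - y t) - (z s - y s)" by (simp add: incr_def)
        then show ?thesis
          using norm_triangle_ineq4[of "z t - y t" "z s - y s"] sup[of t] sup[of s] st by simp
      qed
      also have "\<dots> \<le> 2 * \<epsilon>1 * (r / w\<^sup>2)"
        using mult_left_mono[OF rw(4), of "2 * \<epsilon>1"] eps_1 by simp
      also have "\<dots> \<le> (2 + 2 * K\<^sup>2) * \<epsilon>1 * (r / w\<^sup>2)"
        using eps_1 r by (intro mult_right_mono) auto
      finally show ?F1 by (simp add: C1_def r_def)
      have 1: "norm ((g (z s) - g (y s)) *v incr X' s t) \<le> (K * \<epsilon>1) * (K * r)"
      proof (rule order_trans[OF norm_matrix_vector_mult_le mult_mono])
        show "norm (g (z s) - g (y s)) \<le> K * \<epsilon>1"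
          by (rule order_trans[OF g_lip mult_left_mono]) (use sup[of s] st in auto)
        show "norm (incr X' s t) \<le> K * r" using incr_boundD[OF X'K st] by (simp add: r_def)
      qed (use eps_1 in auto)
      have 2: "norm (g (y s) *v (incr X' s t - incr X s t)) \<le> K * (\<epsilon>1 * r)"
      proof (rule order_trans[OF norm_g_mult_le mult_left_mono])
        show "norm (incr X' s t - incr X s t) \<le> \<epsilon>1 * r"
          using order_trans[OF incr_boundD[OF dX st, unfolded power_one_right, folded r_def]
              mult_right_mono[OF eps1(1)]] r by simp
      qed simp
      have deq: "remainder g X' z s t - remainder g X y s t = (incr z s t - incr y s t)
          - ((g (z s) - g (y s)) *v incr X' s t + g (y s) *v (incr X' s t - incr X s t))"
        by (simp add: remainder_def matrix_vector_mult_diff_rdistrib matrix_vector_mult_diff_distrib)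
      have "norm (remainder g X' z s t - remainder g X y s t) \<le> 2 * \<epsilon>1 + ((K * \<epsilon>1) * (K * r) + K * (\<epsilon>1 * r))"
        unfolding deq
        by (rule order_trans[OF norm_triangle_ineq4 add_mono[OF incr_le norm_triangle_mono[OF 1 2]]])
      also have "\<dots> = 2 * \<epsilon>1 * 1 + (K\<^sup>2 + K) * \<epsilon>1 * r" by (simp add: power2_eq_square algebra_simps)
      also have "\<dots> \<le> 2 * \<epsilon>1 * (r\<^sup>2 / w\<^sup>2) + (K\<^sup>2 + K\<^sup>2) * \<epsilon>1 * (r / w\<^sup>2 * r)"
        using rw eps_1 r K_ge_1 self_le_power[of K 2] by (intro add_mono mult_mono mult_left_mono) auto
      also have "\<dots> = C1 * \<epsilon>1 * r\<^sup>2"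
        using w by (simp add: C1_def power2_eq_square divide_simps) (simp add: algebra_simps)
      finally show ?F2 by (simp add: r_def)
    qed
    show "(\<forall>t\<in>{a..e}. norm (z t - y t) \<le> C * \<epsilon>) \<and>
       incr_bound \<beta> 1 a e (\<lambda>s t. incr z s t - incr y s t) (C * \<epsilon>) \<and>
       incr_bound \<beta> 2 a e (\<lambda>s t. remainder g X' z s t - remainder g X y s t) (C * \<epsilon>)"
      unfolding incr_bound_def
    proof (intro conjI allI impI ballI)
      fix t assume "t \<in> {a..e}"
      then show "norm (z t - y t) \<le> C * \<epsilon>"
        using sup[of t] mult_right_mono[OF GNC eps] by (auto simp: \<epsilon>1_def)
    next
      fix s t assume st: "a \<le> s" "s \<le> t" "t \<le> e"
      then have ds: "norm (z s - y s) \<le> \<epsilon>1" using sup by simp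
      show "norm (incr z s t - incr y s t) \<le> C * \<epsilon> * ((t - s) powr \<beta>) ^ 1"
        using window(2)[OF st _ eps1 ds] far(1)[OF st] le_C[of "(t - s) powr \<beta>"]
        by (cases "t - s \<le> h") auto
      show "norm (remainder g X' z s t - remainder g X y s t) \<le> C * \<epsilon> * ((t - s) powr \<beta>)\<^sup>2"
        using window(3)[OF st _ eps1 ds] far(2)[OF st] le_C[of "((t - s) powr \<beta>)\<^sup>2"]
        by (cases "t - s \<le> h") auto
    qed
  qed
qed

section \<open>From the norms of the statement to increment bounds and back\<close>

lemma incr_bound_minus_commute:
  "incr_bound \<beta> n a e (\<lambda>s t. F s t - G s t) C \<Longrightarrow> incr_bound \<beta> n a e (\<lambda>s t. G s t - F s t) C"
  by (simp add: incr_bound_def norm_minus_commute)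

lemma incr_bound_of_hoelder:
  assumes le: "hoelder (real n * \<beta>) a e F \<le> ennreal C" and "0 \<le> C" and "n > 0"
    and diag: "\<And>s. a \<le> s \<Longrightarrow> s \<le> e \<Longrightarrow> F s s = 0"
  shows "incr_bound \<beta> n a e F C"
  unfolding incr_bound_def
proof (intro allI impI)
  fix s t assume st: "a \<le> s" "s \<le> t" "t \<le> e"
  show "norm (F s t) \<le> C * ((t - s) powr \<beta>) ^ n"
  proof (cases "s = t")
    case True
    then show ?thesis using diag st \<open>0 \<le> C\<close> by simp
  next
    case False
    then have "s < t" using st by simp
    have "ennreal (norm (F s t) / (t - s) powr (real n * \<beta>)) \<le> hoelder (real n * \<beta>) a e F"
      unfolding hoelder_def by (rule SUP_upper2[of "(s, t)"]) (use st \<open>s < t\<close> in auto)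
    then have "norm (F s t) / (t - s) powr (real n * \<beta>) \<le> C"
      using le \<open>0 \<le> C\<close> by (meson ennreal_le_iff order_trans)
    then show ?thesis
      using \<open>s < t\<close> by (simp add: powr_scale_power[OF \<open>n > 0\<close>] pos_divide_le_eq)
  qed
qed

lemma incr_bound_of_hoelder_finite:
  assumes "hoelder (real n * \<beta>) a e F < top" and "n > 0"
    and "\<And>s. a \<le> s \<Longrightarrow> s \<le> e \<Longrightarrow> F s s = 0"
  shows "\<exists>C\<ge>0. incr_bound \<beta> n a e F C"
proof (intro exI conjI)
  show "0 \<le> enn2real (hoelder (real n * \<beta>) a e F)" by simp
  show "incr_bound \<beta> n a e F (enn2real (hoelder (real n * \<beta>) a e F))"
    by (rule incr_bound_of_hoelder) (use assms in auto)
qed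

lemma ennreal_powr_le:
  assumes "x \<le> ennreal c" and "0 \<le> c" and "0 \<le> r"
  shows "ennreal_powr x r \<le> ennreal (c powr r)"
proof -
  have "x \<noteq> top" using assms(1) by (auto simp: top_unique)
  moreover have "enn2real x \<le> c" using enn2real_mono[OF assms(1)] assms(2) by simp
  ultimately show ?thesis
    using assms by (auto simp: ennreal_powr_def intro!: ennreal_leI powr_mono2)
qed

text \<open>The exponent is such that the \<open>p\<close>-th power of the bound is linear in the length of an interval, so
  the sum over a partition telescopes.\<close>

lemma p_var_le_of_incr_bound:
  assumes F: "incr_bound \<beta> n a e F C" and "0 \<le> C" and "n > 0" and "\<beta> > 0" and "a \<le> e"
    and p: "p = 1 / (real n * \<beta>)"
  shows "p_var p a e F \<le> ennreal (C * ((e - a) powr \<beta>) ^ n)"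
proof -
  have p0: "p > 0" using assms by simp
  have "partition_sum ts (\<lambda>u v. norm (F u v) powr p) \<le> C powr p * (e - a)"
    if ts: "is_partition a e ts" for ts
  proof -
    have sorted: "ts ! i < ts ! j" if "i < j" "j < length ts" for i j
      using ts that by (auto simp: is_partition_def sorted_wrt_iff_nth_less)
    have first: "ts ! 0 = a" and last: "ts ! (length ts - 1) = e" and ne: "ts \<noteq> []"
      using ts by (auto simp: is_partition_def hd_conv_nth last_conv_nth)
    have "norm (F (ts ! k) (ts ! Suc k)) powr p \<le> C powr p * (ts ! Suc k - ts ! k)"
      if k: "k < length ts - 1" for k
    proof -
      let ?u = "ts ! k" and ?v = "ts ! Suc k"
      have k': "k < length ts" "Suc k < length ts" using k by auto
      have "?u < ?v" using sorted[of k "Suc k"] k by simp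
      moreover have "a \<le> ?u" using sorted[of 0 k] first k' by (cases "k = 0") auto
      moreover have "?v \<le> e"
      proof (cases "Suc k = length ts - 1")
        case False
        then have "Suc k < length ts - 1" "length ts - 1 < length ts" using k by linarith+
        then show ?thesis using sorted last by fastforce
      qed (use last in simp)
      ultimately have "norm (F ?u ?v) powr p \<le> (C * (?v - ?u) powr (real n * \<beta>)) powr p"
        using incr_boundD[OF F, of ?u ?v] p0 by (intro powr_mono2) (auto simp: powr_scale_power[OF \<open>n > 0\<close>])
      also have "\<dots> = C powr p * (?v - ?u)"
        using \<open>?u < ?v\<close> assms by (simp add: powr_mult powr_powr)
      finally show ?thesis .
    qed
    then have "partition_sum ts (\<lambda>u v. norm (F u v) powr p) \<le>
        (\<Sum>k<length ts - 1. C powr p * (ts ! Suc k - ts ! k))"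
      unfolding partition_sum_def by (intro sum_mono) auto
    also have "\<dots> = C powr p * (e - a)"
      by (simp add: sum_distrib_left[symmetric] sum_lessThan_telescope first last[simplified])
    finally show ?thesis .
  qed
  then have "p_var p a e F \<le> ennreal ((C powr p * (e - a)) powr (1 / p))"
    unfolding p_var_def
    using p0 \<open>a \<le> e\<close> by (intro ennreal_powr_le SUP_least) (auto intro: ennreal_leI)
  also have "(C powr p * (e - a)) powr (1 / p) = C * ((e - a) powr \<beta>) ^ n"
    using assms p0 by (simp add: powr_mult powr_powr powr_scale_power)
  finally show ?thesis .
qed

lemma sup_norm_le: "(\<And>t. t \<in> {a..e} \<Longrightarrow> norm (y t) \<le> C) \<Longrightarrow> sup_norm a e y \<le> ennreal C"
  unfolding sup_norm_def by (intro SUP_least ennreal_leI)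

lemma chen_relation_of_rough_path: "rough_path \<beta> a e X XX \<Longrightarrow> chen_relation a e X XX"
  unfolding rough_path_def chen_relation_def by (simp add: diff_eq_eq add_ac)

lemma chen_relation_diagonal:
  assumes "chen_relation a e X XX" and "a \<le> s" "s \<le> e" shows "XX s s = 0"
proof -
  have "XX s s = XX s s + XX s s + outer (incr X s s) (incr X s s)"
    using assms unfolding chen_relation_def by blast
  moreover have "outer (incr X s s) (incr X s s) = 0" by (simp add: outer_def incr_def vec_eq_iff)
  ultimately show ?thesis by simp
qed

lemma rde_solutionD:
  fixes X :: "real \<Rightarrow> real^'d" and y :: "real \<Rightarrow> real^'m"
  assumes "rde_solution \<beta> A f g X XX a e y"
  shows "rde_equation g (\<lambda>x. A *v x + f x) a e X XX y"
    and "\<exists>C\<ge>0. incr_bound \<beta> 1 a e (incr y) C"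
    and "\<exists>C\<ge>0. incr_bound \<beta> 2 a e (remainder g X y) C"
proof -
  have "germ g X XX y = (\<lambda>u v. g (y u) *v incr X u v + Dg_g g (y u) (XX u v))"
    by (intro ext) (simp add: germ_def)
  then show "rde_equation g (\<lambda>x. A *v x + f x) a e X XX y"
    using assms by (auto simp: rde_solution_def rde_equation_def has_rough_integral_def)
  show "\<exists>C\<ge>0. incr_bound \<beta> 1 a e (incr y) C"
    by (rule incr_bound_of_hoelder_finite) (use assms in \<open>auto simp: rde_solution_def incr_def\<close>)
  show "\<exists>C\<ge>0. incr_bound \<beta> 2 a e (remainder g X y) C"
    by (rule incr_bound_of_hoelder_finite)
       (use assms in \<open>auto simp: rde_solution_def incr_def remainder_def\<close>)
qed

section \<open>The smooth approximations satisfy the relation of Chen\<close>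

lemma bounded_linear_outer: "bounded_linear (outer x :: real^'d \<Rightarrow> real^'d^'d)"
  by (rule linear_conv_bounded_linear[THEN iffD1])
     (auto simp: linear_iff outer_def vec_eq_iff algebra_simps)

text \<open>Splitting the iterated integral at \<open>u\<close> leaves the constant \<open>incr W s u\<close> tensored with
  \<open>\<integral>\<^sub>u\<^sup>t dW\<close>.\<close>

lemma chen_relation_smooth_lift:
  fixes W \<phi> :: "real \<Rightarrow> real^'d"
  assumes deriv: "\<And>x. (W has_vector_derivative \<phi> x) (at x)" and cont: "continuous_on UNIV \<phi>"
  shows "chen_relation a e W (smooth_lift W)"
  unfolding chen_relation_def
proof (intro allI impI)
  fix s u t assume sut: "a \<le> s" "s \<le> u" "u \<le> t" "t \<le> e"
  have lift: "smooth_lift W s t = integral {s..t} (\<lambda>r. outer (incr W s r) (\<phi> r))" for s t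
    unfolding smooth_lift_def using vector_derivative_at[OF deriv] by simp
  have contW: "continuous_on UNIV W"
    by (rule continuous_at_imp_continuous_on) (use deriv has_vector_derivative_continuous in blast)
  have "continuous_on S (\<lambda>r. outer (incr W s r) (\<phi> r))" for S s
    unfolding outer_def incr_def
    by (intro continuous_intros continuous_on_subset[OF contW] continuous_on_subset[OF cont]) auto
  then have int: "(\<lambda>r. outer (incr W s r) (\<phi> r)) integrable_on {x..y}" for s x y
    by (rule integrable_continuous_real)
  have int\<phi>: "\<phi> integrable_on {u..t}"
    by (rule integrable_continuous_real) (rule continuous_on_subset[OF cont], simp)
  have "(\<phi> has_integral W t - W u) {u..t}"
    by (rule fundamental_theorem_of_calculus)
       (use sut in \<open>auto intro: has_vector_derivative_at_within[OF deriv]\<close>)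
  then have I\<phi>: "integral {u..t} \<phi> = incr W u t" by (simp add: incr_def integral_unique)
  have outer_int: "(\<lambda>r. outer c (\<phi> r)) integrable_on {u..t}"
      "integral {u..t} (\<lambda>r. outer c (\<phi> r)) = outer c (integral {u..t} \<phi>)" for c
    using integrable_linear[OF int\<phi> bounded_linear_outer[of c]]
      integral_linear[OF int\<phi> bounded_linear_outer[of c]] by (simp_all add: o_def)
  have "smooth_lift W s t = smooth_lift W s u + integral {u..t} (\<lambda>r. outer (incr W s r) (\<phi> r))"
    unfolding lift using Henstock_Kurzweil_Integration.integral_combine[OF sut(2,3) int] by simp
  also have "(\<lambda>r. outer (incr W s r) (\<phi> r)) = (\<lambda>r. outer (incr W u r) (\<phi> r) + outer (incr W s u) (\<phi> r))"
    by (auto simp: outer_def incr_def vec_eq_iff algebra_simps)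
  also have "integral {u..t} \<dots> = smooth_lift W u t + outer (incr W s u) (incr W u t)"
    unfolding lift
    using integral_add[OF int[of u u t] outer_int(1)[of "incr W s u"]] outer_int(2)[of "incr W s u"] I\<phi>
    by simp
  finally show "smooth_lift W s t = smooth_lift W s u + smooth_lift W u t + outer (incr W s u) (incr W u t)"
    by simp
qed

lemma chen_relation_W_approx:
  fixes w :: "real \<Rightarrow> real^'d"
  assumes "continuous_on UNIV w"
  shows "chen_relation a e (W_approx \<delta> w) (WW_approx \<delta> w)"
  unfolding WW_approx_def
proof (rule chen_relation_smooth_lift)
  let ?\<phi> = "\<lambda>r. (1 / \<delta>) *\<^sub>R (w (r + \<delta>) - w r)"
  show cont: "continuous_on UNIV ?\<phi>"
    by (intro continuous_intros continuous_on_compose2[OF assms] assms) auto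
  fix x :: real
  define N where "N = \<bar>x\<bar> + 1"
  have "((\<lambda>t. LBINT r=ereal 0..ereal t. ?\<phi> r) has_vector_derivative ?\<phi> x) (at x within {- N..N})"
    by (rule interval_integral_FTC2)
       (auto simp: N_def intro: continuous_on_subset[OF cont])
  moreover have "at x within {- N..N} = at x"
    by (rule at_within_interior) (auto simp: N_def)
  ultimately show "(W_approx \<delta> w has_vector_derivative ?\<phi> x) (at x)"
    unfolding W_approx_def[abs_def] zero_ereal_def by simp
qed

section \<open>Convergence of the solutions\<close>

theorem theorem4p1:
  fixes H \<beta> p q \<tau> T :: real
    and A :: "real^'m^'m"
    and f :: "real^'m \<Rightarrow> real^'m"
    and g :: "real^'m \<Rightarrow> real^'d^'m"
    and P :: "(real \<Rightarrow> real^'d) measure"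
    and \<omega>2 :: "(real \<Rightarrow> real^'d) \<Rightarrow> real \<Rightarrow> real \<Rightarrow> real^'d^'d"
    and \<Omega>' :: "(real \<Rightarrow> real^'d) set"
    and \<omega> :: "real \<Rightarrow> real^'d"
    and y :: "real \<Rightarrow> real^'m"
    and y\<delta> :: "real \<Rightarrow> real \<Rightarrow> real^'m"
  assumes "1 / 3 < H" and "H \<le> 1 / 2"
    and "1 / 3 < \<beta>" and "\<beta> < H"
    and "p = 1 / \<beta>" and "q = p / 2"
    and "\<exists>K. K-lipschitz_on UNIV f"
    and "C3_bounded g"
    and "canonical_fbm H P"
    and "canonical_lift P \<omega>2"
    and "good_set \<beta> P \<omega>2 \<Omega>'"
    and "\<omega> \<in> \<Omega>'"
    and "T > 0"
    and "rde_solution \<beta> A f g \<omega> (\<omega>2 \<omega>) \<tau> (\<tau> + T) y"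
    and "\<And>\<delta>. 0 < \<delta> \<Longrightarrow> \<delta> < 1 \<Longrightarrow>
           rde_solution \<beta> A f g (W_approx \<delta> \<omega>) (WW_approx \<delta> \<omega>) \<tau> (\<tau> + T) (y\<delta> \<delta>)"
    and "((\<lambda>\<delta>. norm (y\<delta> \<delta> \<tau> - y \<tau>)) \<longlongrightarrow> 0) (at_right 0)"
  shows "((\<lambda>\<delta>. sup_norm \<tau> (\<tau> + T) (\<lambda>t. y t - y\<delta> \<delta> t)
             + p_var p \<tau> (\<tau> + T) (incr (\<lambda>t. y t - y\<delta> \<delta> t))
             + p_var q \<tau> (\<tau> + T)
                 (\<lambda>s t. remainder g (W_approx \<delta> \<omega>) (y\<delta> \<delta>) s t - remainder g \<omega> y s t))
          \<longlongrightarrow> 0) (at_right 0)"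
proof -
  note \<beta> = assms(1-4) and pq = assms(5,6) and f = assms(7) and g = assms(8) and fbm = assms(9)
    and good = assms(11) and \<omega> = assms(12) and T = assms(13) and y = assms(14) and y\<delta> = assms(15)
    and init = assms(16)
  have \<beta>0: "0 < \<beta>" "\<beta> < 1 / 2" using \<beta> by auto
  define e where "e = \<tau> + T"
  \<comment> \<open>The convergence of the lifts is available on symmetric intervals, so \<open>[\<tau>, e]\<close> is placed inside \<open>[- N, N]\<close>.\<close>
  define N where "N = \<bar>\<tau>\<bar> + T"
  have e: "\<tau> \<le> e" and N: "N > 0" "- N \<le> \<tau>" "e \<le> N" using T by (auto simp: e_def N_def)
  define b where "b = (\<lambda>x. A *v x + f x)"
  let ?R = "\<lambda>\<delta>. remainder g (W_approx \<delta> \<omega>) (y\<delta> \<delta>)"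

  obtain L where L: "L-lipschitz_on UNIV f" using f by blast
  have "norm (b x - b z) \<le> (norm A + L) * norm (x - z)" for x z
  proof -
    have "b x - b z = A *v (x - z) + (f x - f z)"
      by (simp add: b_def matrix_vector_mult_diff_distrib)
    then show ?thesis
      using norm_triangle_mono[OF norm_matrix_vector_mult_le[of A "x - z"], of "f x - f z" "L * norm (x - z)"]
        lipschitz_onD[OF L, of x z] by (simp add: dist_norm distrib_right)
  qed
  then obtain K D where field: "rde_field \<beta> K g D b"
    using rde_field_exists[OF \<beta>(3) \<beta>0(2) g] by blast

  have cont: "continuous_on UNIV \<omega>" using fbm good \<omega> by (auto simp: canonical_fbm_def good_set_def)
  have rough: "rough_path \<beta> \<tau> e \<omega> (\<omega>2 \<omega>)"
    using good \<omega> e by (auto simp: good_set_def geometric_rough_path_def)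
  note chen = chen_relation_of_rough_path[OF rough]
  obtain M1 where M1: "incr_bound \<beta> 1 \<tau> e (incr \<omega>) M1"
    using incr_bound_of_hoelder_finite[of 1 \<beta> \<tau> e "incr \<omega>"] rough by (auto simp: rough_path_def incr_def)
  obtain M2 where M2: "incr_bound \<beta> 2 \<tau> e (\<omega>2 \<omega>) M2"
    using incr_bound_of_hoelder_finite[of 2 \<beta> \<tau> e "\<omega>2 \<omega>"] rough chen_relation_diagonal[OF chen]
    by (auto simp: rough_path_def)
  obtain M3 where M3: "incr_bound \<beta> 1 \<tau> e (incr y) M3" using rde_solutionD(2)[OF y] by (auto simp: e_def)
  obtain M4 where M4: "incr_bound \<beta> 2 \<tau> e (remainder g \<omega> y) M4"
    using rde_solutionD(3)[OF y] by (auto simp: e_def)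
  define M where "M = Max {M1, M2, M3, M4}"
  have M: "M1 \<le> M" "M2 \<le> M" "M3 \<le> M" "M4 \<le> M" by (auto simp: M_def)
  obtain C where C: "0 \<le> C" and stable:
    "\<And>\<epsilon> X' XX' z \<rho>'. 0 \<le> \<epsilon> \<Longrightarrow> C * \<epsilon> \<le> 1 \<Longrightarrow>
       incr_bound \<beta> 1 \<tau> e (\<lambda>s t. incr X' s t - incr \<omega> s t) \<epsilon> \<Longrightarrow>
       incr_bound \<beta> 2 \<tau> e (\<lambda>s t. XX' s t - \<omega>2 \<omega> s t) \<epsilon> \<Longrightarrow>
       chen_relation \<tau> e X' XX' \<Longrightarrow> rde_equation g b \<tau> e X' XX' z \<Longrightarrow>
       incr_bound \<beta> 2 \<tau> e (remainder g X' z) \<rho>' \<Longrightarrow> norm (z \<tau> - y \<tau>) \<le> \<epsilon> \<Longrightarrow>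
       (\<forall>t\<in>{\<tau>..e}. norm (z t - y t) \<le> C * \<epsilon>) \<and>
       incr_bound \<beta> 1 \<tau> e (\<lambda>s t. incr z s t - incr y s t) (C * \<epsilon>) \<and>
       incr_bound \<beta> 2 \<tau> e (\<lambda>s t. remainder g X' z s t - remainder g \<omega> y s t) (C * \<epsilon>)"
    using rde_stability[OF field e incr_bound_mono[OF M1 M(1)] incr_bound_mono[OF M2 M(2)] chen
      rde_solutionD(1)[OF y, folded b_def e_def] incr_bound_mono[OF M3 M(3)] incr_bound_mono[OF M4 M(4)]]
    by blast

  define h where "h \<delta> = hoelder \<beta> (- N) N (\<lambda>s t. incr \<omega> s t - incr (W_approx \<delta> \<omega>) s t)
            + hoelder (2 * \<beta>) (- N) N (\<lambda>s t. \<omega>2 \<omega> s t - WW_approx \<delta> \<omega> s t)" for \<delta>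
  have h: "(h \<longlongrightarrow> 0) (at_right 0)"
    using good \<omega> N by (auto simp: good_set_def h_def[abs_def])
  define \<epsilon> where "\<epsilon> \<delta> = norm (y\<delta> \<delta> \<tau> - y \<tau>) + enn2real (h \<delta>)" for \<delta>
  have \<epsilon>_nonneg: "0 \<le> \<epsilon> \<delta>" for \<delta> by (simp add: \<epsilon>_def)
  have \<epsilon>_lim: "(\<epsilon> \<longlongrightarrow> 0) (at_right 0)"
    unfolding \<epsilon>_def using tendsto_add[OF init tendsto_enn2real[of h 0]] h by simp
  define S where "S = 1 + (e - \<tau>) powr \<beta> + ((e - \<tau>) powr \<beta>)\<^sup>2"

  have le: "sup_norm \<tau> e (\<lambda>t. y t - y\<delta> \<delta> t) + p_var p \<tau> e (incr (\<lambda>t. y t - y\<delta> \<delta> t))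
      + p_var q \<tau> e (\<lambda>s t. ?R \<delta> s t - remainder g \<omega> y s t) \<le> ennreal (C * \<epsilon> \<delta> * S)"
    if \<delta>: "0 < \<delta>" "\<delta> < 1" and h1: "h \<delta> < 1" and C1: "C * \<epsilon> \<delta> < 1" for \<delta>
  proof -
    have "h \<delta> = ennreal (enn2real (h \<delta>))" using h1 by (simp add: less_top order.strict_trans)
    also have "\<dots> \<le> ennreal (\<epsilon> \<delta>)" by (intro ennreal_leI) (simp add: \<epsilon>_def)
    finally have h_le: "h \<delta> \<le> ennreal (\<epsilon> \<delta>)" .
    note chen\<delta> = chen_relation_W_approx[OF cont]
    have chenN: "chen_relation (- N) N \<omega> (\<omega>2 \<omega>)"
      using good \<omega> N by (intro chen_relation_of_rough_path[of \<beta>]) (auto simp: good_set_def geometric_rough_path_def)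
    have "incr_bound \<beta> 1 (- N) N (\<lambda>s t. incr \<omega> s t - incr (W_approx \<delta> \<omega>) s t) (\<epsilon> \<delta>)"
    proof (rule incr_bound_of_hoelder)
      show "hoelder (real 1 * \<beta>) (- N) N (\<lambda>s t. incr \<omega> s t - incr (W_approx \<delta> \<omega>) s t) \<le> ennreal (\<epsilon> \<delta>)"
        by (rule order_trans[OF _ h_le]) (simp add: h_def)
    qed (use \<epsilon>_nonneg in \<open>auto simp: incr_def\<close>)
    from incr_bound_minus_commute[OF incr_bound_subinterval[OF this N(2,3)]]
    have dX: "incr_bound \<beta> 1 \<tau> e (\<lambda>s t. incr (W_approx \<delta> \<omega>) s t - incr \<omega> s t) (\<epsilon> \<delta>)" .
    have "incr_bound \<beta> 2 (- N) N (\<lambda>s t. \<omega>2 \<omega> s t - WW_approx \<delta> \<omega> s t) (\<epsilon> \<delta>)"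
    proof (rule incr_bound_of_hoelder)
      show "hoelder (real 2 * \<beta>) (- N) N (\<lambda>s t. \<omega>2 \<omega> s t - WW_approx \<delta> \<omega> s t) \<le> ennreal (\<epsilon> \<delta>)"
        by (rule order_trans[OF _ h_le]) (simp add: h_def)
    qed (use \<epsilon>_nonneg chen_relation_diagonal[OF chenN] chen_relation_diagonal[OF chen\<delta>[of "- N" N]] in auto)
    from incr_bound_minus_commute[OF incr_bound_subinterval[OF this N(2,3)]]
    have dXX: "incr_bound \<beta> 2 \<tau> e (\<lambda>s t. WW_approx \<delta> \<omega> s t - \<omega>2 \<omega> s t) (\<epsilon> \<delta>)" .
    note sol = rde_solutionD[OF y\<delta>[OF \<delta>], folded b_def e_def]
    obtain \<rho>' where \<rho>': "incr_bound \<beta> 2 \<tau> e (?R \<delta>) \<rho>'" using sol(3) by blast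
    have "norm (y\<delta> \<delta> \<tau> - y \<tau>) \<le> \<epsilon> \<delta>" by (simp add: \<epsilon>_def)
    note est = stable[OF \<epsilon>_nonneg less_imp_le[OF C1] dX dXX chen\<delta> sol(1) \<rho>' this]
    have C\<epsilon>: "0 \<le> C * \<epsilon> \<delta>" using C \<epsilon>_nonneg by simp
    have "sup_norm \<tau> e (\<lambda>t. y t - y\<delta> \<delta> t) \<le> ennreal (C * \<epsilon> \<delta>)"
      by (rule sup_norm_le) (use est in \<open>simp add: norm_minus_commute\<close>)
    moreover have "p_var p \<tau> e (incr (\<lambda>t. y t - y\<delta> \<delta> t)) \<le> ennreal (C * \<epsilon> \<delta> * ((e - \<tau>) powr \<beta>) ^ 1)"
    proof (rule p_var_le_of_incr_bound)
      have "norm (incr (\<lambda>t. y t - y\<delta> \<delta> t) s t) = norm (incr (y\<delta> \<delta>) s t - incr y s t)" for s t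
      proof -
        have "incr (\<lambda>t. y t - y\<delta> \<delta> t) s t = - (incr (y\<delta> \<delta>) s t - incr y s t)" by (simp add: incr_def)
        then show ?thesis by (simp only: norm_minus_cancel)
      qed
      then show "incr_bound \<beta> 1 \<tau> e (incr (\<lambda>t. y t - y\<delta> \<delta> t)) (C * \<epsilon> \<delta>)"
        using est by (simp add: incr_bound_def)
    qed (use pq \<beta>0 e C\<epsilon> in auto)
    moreover have "p_var q \<tau> e (\<lambda>s t. ?R \<delta> s t - remainder g \<omega> y s t) \<le> ennreal (C * \<epsilon> \<delta> * ((e - \<tau>) powr \<beta>) ^ 2)"
      by (rule p_var_le_of_incr_bound) (use est pq \<beta>0 e C\<epsilon> in auto)
    ultimately have "sup_norm \<tau> e (\<lambda>t. y t - y\<delta> \<delta> t) + p_var p \<tau> e (incr (\<lambda>t. y t - y\<delta> \<delta> t))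
      + p_var q \<tau> e (\<lambda>s t. ?R \<delta> s t - remainder g \<omega> y s t) \<le>
      ennreal (C * \<epsilon> \<delta>) + ennreal (C * \<epsilon> \<delta> * ((e - \<tau>) powr \<beta>) ^ 1) + ennreal (C * \<epsilon> \<delta> * ((e - \<tau>) powr \<beta>) ^ 2)"
      by (intro add_mono)
    also have "\<dots> = ennreal (C * \<epsilon> \<delta> * S)"
      using C\<epsilon> by (simp add: S_def ennreal_plus[symmetric] distrib_left del: ennreal_plus)
    finally show ?thesis .
  qed

  have "eventually (\<lambda>\<delta>. 0 < \<delta> \<and> \<delta> < (1::real)) (at_right 0)"
    unfolding eventually_at_right_field by (rule exI[of _ 1]) auto
  moreover have "eventually (\<lambda>\<delta>. h \<delta> < 1) (at_right 0)"
    using order_tendstoD(2)[OF h] by simp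
  moreover have "eventually (\<lambda>\<delta>. C * \<epsilon> \<delta> < 1) (at_right 0)"
    using order_tendstoD(2)[OF tendsto_mult_right_zero[OF \<epsilon>_lim, of C]] by simp
  ultimately have ev: "\<forall>\<^sub>F \<delta> in at_right 0. sup_norm \<tau> e (\<lambda>t. y t - y\<delta> \<delta> t) + p_var p \<tau> e (incr (\<lambda>t. y t - y\<delta> \<delta> t))
      + p_var q \<tau> e (\<lambda>s t. ?R \<delta> s t - remainder g \<omega> y s t) \<le> ennreal (C * \<epsilon> \<delta> * S)"
    by eventually_elim (use le in blast)
  have "((\<lambda>\<delta>. ennreal (C * \<epsilon> \<delta> * S)) \<longlongrightarrow> ennreal (C * 0 * S)) (at_right 0)"
    by (intro tendsto_intros \<epsilon>_lim)
  then have lim: "((\<lambda>\<delta>. ennreal (C * \<epsilon> \<delta> * S)) \<longlongrightarrow> 0) (at_right 0)" by simp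
  show ?thesis
    unfolding e_def[symmetric]
    by (rule tendsto_sandwich[OF _ ev tendsto_const lim]) simp
qed

end
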